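(* Let $K$ be a field of characteristic $p\ge 0$. For every associative commutative $K$-algebra $U$ with derivation $\partial$, the following generalized Wronskians (with $r,l$ integers) are $n$-Lie multiplications on $U$: - $n=2$: if $p=2$, $V^{2^r-2^l,\,2^r}$ for $0\le l\le r$; if $p=2$, $\sum_{i=1}^{2^l}V^{i,\,2^l+1-i}$ for $l>0$; if $p=3$, $V^{2\cdot 3^r,\,3^{r+1}}$ for $r\ge 0$. - $n=3$: if $p=2$, $V^{1,2,4}$; if $p=2$, $V^{2,3,4}$; if $p=2$, $\sum_{i=1}^{2^l}V^{0,\,i,\,2^l+1-i}$ for $l>0$; if $p=3$, $V^{1,2,3}$. - $n=4$: if $p=2$, $V^{1,2,3,4}$; if $p=3$, $V^{0,1,2,3}$. - $n=5$: if $p=2$, $V^{0,1,2,3,4}$. Moreover, over a field $K$ of characteristic $0$, for $k\ge 1$ the Wronskian $V^{0,1,\ldots,k}$ is an $n$-Lie multiplication (with $n=k+1$) on every associative commutative $K$-algebra with derivation only in the case of Lie algebras, $n=2$, $k=1$.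
   Context: For an associative commutative algebra $U$ with derivation $\partial$ and non-negative integers $i_1,\ldots,i_n$, the generalized Wronskian is the $n$-linear map $V^{i_1,\ldots,i_n}(u_1,\ldots,u_n)=\det\big(\partial^{i_s}u_t\big)_{1\le s,t\le n}$. An $n$-linear map $\omega:A\times\cdots\times A\to A$ on a vector space $A$ is an $n$-Lie multiplication if $\omega$ is skew-symmetric (alternating) and for all $a_1,\ldots,a_{n-1}\in A$ the map $D:a\mapsto\omega(a_1,\ldots,a_{n-1},a)$ satisfies $D(\omega(b_1,\ldots,b_n))=\sum_{i=1}^n\omega(b_1,\ldots,b_{i-1},D(b_i),b_{i+1},\ldots,b_n)$ for all $b_1,\ldots,b_n\in A$. *)

theory Defs
  imports "HOL-Algebra.Algebra" "HOL-Combinatorics.Permutations"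
begin

definition ring_char :: "('a, 'm) ring_scheme \<Rightarrow> nat" where
  "ring_char R =
     (if \<exists>n::nat. n > 0 \<and> [n] \<cdot>\<^bsub>R\<^esub> \<one>\<^bsub>R\<^esub> = \<zero>\<^bsub>R\<^esub>
      then LEAST n::nat. n > 0 \<and> [n] \<cdot>\<^bsub>R\<^esub> \<one>\<^bsub>R\<^esub> = \<zero>\<^bsub>R\<^esub>
      else 0)"

text \<open>
  Unlike in the library locale \<^locale>\<open>algebra\<close>, no unit element is required: the \<open>one\<close> field
  of the record \<open>U\<close> is never referred to.
\<close>

locale assoc_comm_algebra = module K U
  for K :: "('k, 'm) ring_scheme" and U :: "('k, 'u, 'z) module_scheme" +
  assumes mult_closed: "\<lbrakk>x \<in> carrier U; y \<in> carrier U\<rbrakk> \<Longrightarrow> x \<otimes>\<^bsub>U\<^esub> y \<in> carrier U"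
    and mult_assoc: "\<lbrakk>x \<in> carrier U; y \<in> carrier U; z \<in> carrier U\<rbrakk> \<Longrightarrow>
      (x \<otimes>\<^bsub>U\<^esub> y) \<otimes>\<^bsub>U\<^esub> z = x \<otimes>\<^bsub>U\<^esub> (y \<otimes>\<^bsub>U\<^esub> z)"
    and mult_comm: "\<lbrakk>x \<in> carrier U; y \<in> carrier U\<rbrakk> \<Longrightarrow> x \<otimes>\<^bsub>U\<^esub> y = y \<otimes>\<^bsub>U\<^esub> x"
    and mult_l_distr: "\<lbrakk>x \<in> carrier U; y \<in> carrier U; z \<in> carrier U\<rbrakk> \<Longrightarrow>
      (x \<oplus>\<^bsub>U\<^esub> y) \<otimes>\<^bsub>U\<^esub> z = x \<otimes>\<^bsub>U\<^esub> z \<oplus>\<^bsub>U\<^esub> y \<otimes>\<^bsub>U\<^esub> z"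
    and smult_mult: "\<lbrakk>a \<in> carrier K; x \<in> carrier U; y \<in> carrier U\<rbrakk> \<Longrightarrow>
      (a \<odot>\<^bsub>U\<^esub> x) \<otimes>\<^bsub>U\<^esub> y = a \<odot>\<^bsub>U\<^esub> (x \<otimes>\<^bsub>U\<^esub> y)"

lemma algebra_imp_assoc_comm_algebra:
  assumes "algebra K U"
  shows "assoc_comm_algebra K U"
proof -
  interpret U: cring U using assms by (rule algebra.axioms(2))
  interpret algebra K U by fact
  show ?thesis
    by unfold_locales
      (fact U.m_closed U.m_assoc U.m_comm U.l_distr smult_assoc2)+
qed

definition derivation ::
  "('k, 'm) ring_scheme \<Rightarrow> ('k, 'u, 'z) module_scheme \<Rightarrow> ('u \<Rightarrow> 'u) \<Rightarrow> bool" where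
  "derivation K U d \<longleftrightarrow>
     d \<in> carrier U \<rightarrow> carrier U \<and>
     (\<forall>x\<in>carrier U. \<forall>y\<in>carrier U. d (x \<oplus>\<^bsub>U\<^esub> y) = d x \<oplus>\<^bsub>U\<^esub> d y) \<and>
     (\<forall>a\<in>carrier K. \<forall>x\<in>carrier U. d (a \<odot>\<^bsub>U\<^esub> x) = a \<odot>\<^bsub>U\<^esub> d x) \<and>
     (\<forall>x\<in>carrier U. \<forall>y\<in>carrier U. d (x \<otimes>\<^bsub>U\<^esub> y) = d x \<otimes>\<^bsub>U\<^esub> y \<oplus>\<^bsub>U\<^esub> x \<otimes>\<^bsub>U\<^esub> d y)"

text \<open>
  Since \<open>U\<close> need not have a unit, \<^const>\<open>finprod\<close> is not available for the products in the
  Leibniz formula; they are taken over nonempty lists, and the value at the empty list is a dummy.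
\<close>

fun nonempty_prod :: "('u, 'z) ring_scheme \<Rightarrow> 'u list \<Rightarrow> 'u" where
  "nonempty_prod U [] = \<zero>\<^bsub>U\<^esub>"
| "nonempty_prod U [x] = x"
| "nonempty_prod U (x # y # xs) = x \<otimes>\<^bsub>U\<^esub> nonempty_prod U (y # xs)"

definition determinant :: "('u, 'z) ring_scheme \<Rightarrow> nat \<Rightarrow> (nat \<Rightarrow> nat \<Rightarrow> 'u) \<Rightarrow> 'u" where
  "determinant U n M =
     (\<Oplus>\<^bsub>U\<^esub>\<sigma>\<in>{\<sigma>. \<sigma> permutes {..<n}}.
        (if evenperm \<sigma> then nonempty_prod U (map (\<lambda>s. M s (\<sigma> s)) [0..<n])
         else \<ominus>\<^bsub>U\<^esub> nonempty_prod U (map (\<lambda>s. M s (\<sigma> s)) [0..<n])))"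

text \<open>
  An \<open>n\<close>-ary operation on \<open>U\<close> is a function on lists, of which only the values at lists of
  length \<open>n\<close> with entries in \<open>carrier U\<close> matter. Rows and columns are numbered from 0.
\<close>

definition gen_wronskian ::
  "('u, 'z) ring_scheme \<Rightarrow> ('u \<Rightarrow> 'u) \<Rightarrow> nat list \<Rightarrow> 'u list \<Rightarrow> 'u" where
  "gen_wronskian U d is us = determinant U (length is) (\<lambda>s t. (d ^^ (is ! s)) (us ! t))"

definition tuples :: "('u, 'z) ring_scheme \<Rightarrow> nat \<Rightarrow> 'u list set" where
  "tuples U n = {us. length us = n \<and> set us \<subseteq> carrier U}"

definition n_linear ::
  "('k, 'm) ring_scheme \<Rightarrow> ('k, 'u, 'z) module_scheme \<Rightarrow> nat \<Rightarrow> ('u list \<Rightarrow> 'u) \<Rightarrow> bool" where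
  "n_linear K U n \<omega> \<longleftrightarrow>
     (\<forall>us\<in>tuples U n. \<omega> us \<in> carrier U) \<and>
     (\<forall>us\<in>tuples U n. \<forall>i<n. \<forall>x\<in>carrier U. \<forall>y\<in>carrier U.
        \<omega> (us[i := x \<oplus>\<^bsub>U\<^esub> y]) = \<omega> (us[i := x]) \<oplus>\<^bsub>U\<^esub> \<omega> (us[i := y])) \<and>
     (\<forall>us\<in>tuples U n. \<forall>i<n. \<forall>a\<in>carrier K. \<forall>x\<in>carrier U.
        \<omega> (us[i := a \<odot>\<^bsub>U\<^esub> x]) = a \<odot>\<^bsub>U\<^esub> \<omega> (us[i := x]))"

definition alternating :: "('u, 'z) ring_scheme \<Rightarrow> nat \<Rightarrow> ('u list \<Rightarrow> 'u) \<Rightarrow> bool" where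
  "alternating U n \<omega> \<longleftrightarrow>
     (\<forall>us\<in>tuples U n. \<forall>i<n. \<forall>j<n. i \<noteq> j \<and> us ! i = us ! j \<longrightarrow> \<omega> us = \<zero>\<^bsub>U\<^esub>)"

definition n_Lie_multiplication ::
  "('k, 'm) ring_scheme \<Rightarrow> ('k, 'u, 'z) module_scheme \<Rightarrow> nat \<Rightarrow> ('u list \<Rightarrow> 'u) \<Rightarrow> bool" where
  "n_Lie_multiplication K U n \<omega> \<longleftrightarrow>
     n_linear K U n \<omega> \<and> alternating U n \<omega> \<and>
     (\<forall>as\<in>tuples U (n - 1). \<forall>bs\<in>tuples U n.
        let D = (\<lambda>a. \<omega> (as @ [a]))
        in D (\<omega> bs) = (\<Oplus>\<^bsub>U\<^esub>i\<in>{..<n}. \<omega> (bs[i := D (bs ! i)])))"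

end

theory Submission
  imports Defs "Jordan_Normal_Form.Determinant" "HOL-Library.Poly_Mapping"
begin

text \<open>
  A multilinear differential operator with integer coefficients is an integer polynomial with one
  indeterminate per argument: \<open>\<partial>\<close> of a product of arguments is multiplication by the sum of
  their indeterminates, and \<open>V\<close> with exponents \<open>i\<^sub>1, \<dots>, i\<^sub>n\<close> is the alternant
  \<open>a(z) = det (z\<^sub>t ^ i\<^sub>s)\<close>. The \<open>n\<close>-Lie identity therefore holds in every algebra over a field of
  characteristic \<open>p\<close> as soon as the polynomial
  \<open>a(x, \<Sum>y) a(y) - \<Sum>\<^sub>i a(y with y\<^sub>i replaced by y\<^sub>i + \<Sum>x) a(x, y\<^sub>i)\<close> is divisible by \<open>p\<close>.

  For the exponents \<open>k, \<dots>, k + n - 1\<close> the factor \<open>a(x, t)\<close> is a multiple of \<open>t\<^sup>k \<Prod>(t - x\<^sub>j)\<close>, and by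
  Cramer's rule the sum over \<open>i\<close> is \<open>a(y)\<close> times the trace of a linear map on the polynomials modulo
  \<open>\<Prod>(t - y\<^sub>i)\<close>; this trace involves only a few free coefficients. The alternant with exponents
  1, 2, 4 is additive in each variable modulo 2, and the two families with \<open>n = 2\<close> reduce to small
  identities by the Frobenius map. The two sums over \<open>i\<close> vanish identically, because the
  terms for \<open>i\<close> and \<open>2\<^sup>l + 1 - i\<close> cancel.

  In characteristic 0 the identity is tested on powers of \<open>X\<close> in \<open>K[X]\<close> with the derivation
  \<open>X d/dX\<close>. These are eigenvectors, so the identity becomes an equation between Vandermonde
  determinants of their exponents, which fails for a suitable choice as soon as \<open>k \<ge> 2\<close>.
\<close>

section \<open>Alternants and Cramer's rule\<close>

definition alternant :: "nat list \<Rightarrow> (nat \<Rightarrow> 'a::comm_ring_1) \<Rightarrow> 'a" where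
  "alternant es z = det (mat (length es) (length es) (\<lambda>(s, t). z t ^ (es ! s)))"

text \<open>The Leibniz formula in the shape of \<open>determinant\<close>, so that it can be
  matched with \<open>gen_wronskian\<close> term by term.\<close>

lemma alternant_expand:
  fixes z :: "nat \<Rightarrow> 'a::comm_ring_1"
  shows "alternant es z = (\<Sum>\<sigma> | \<sigma> permutes {..<length es}.
     of_int (sign \<sigma>) * (\<Prod>s<length es. z (\<sigma> s) ^ (es ! s)))"
  unfolding alternant_def
  by (subst det_def'[of _ "length es"])
     (auto simp: atLeast0LessThan permutes_in_image intro!: sum.cong prod.cong)

lemma alternant_cong:
  assumes "\<And>t. t < length es \<Longrightarrow> z t = z' t"
  shows "alternant es z = alternant es z'"
  unfolding alternant_def by (rule arg_cong[of _ _ det], rule eq_matI) (use assms in auto)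

text \<open>Cramer's rule in trace form: the columns \<open>w\<close>, scaled by \<open>g\<close>, are the images of the
  columns of \<open>v\<close> under one linear map \<open>A\<close>.\<close>

lemma sum_det_replace_column:
  fixes g :: "nat \<Rightarrow> 'a::comm_ring_1" and v w A :: "nat \<Rightarrow> nat \<Rightarrow> 'a"
  assumes A: "\<And>i m. i < n \<Longrightarrow> m < n \<Longrightarrow> g i * w m i = (\<Sum>j<n. A m j * v j i)"
  shows "(\<Sum>i<n. g i * det (mat n n (\<lambda>(s, t). if t = i then w s t else v s t))) =
    (\<Sum>m<n. A m m) * det (mat n n (\<lambda>(s, t). v s t))"
proof -
  define V where "V = mat n n (\<lambda>(s, t). v s t)"
  have V: "V \<in> carrier_mat n n" by (simp add: V_def)
  \<comment> \<open>The cofactors along column \<open>i\<close> do not see that column, so they are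
    those of \<open>V\<close>.\<close>
  have rep: "det (mat n n (\<lambda>(s, t). if t = i then w s t else v s t)) =
      (\<Sum>m<n. w m i * cofactor V m i)" if "i < n" for i
  proof -
    let ?W = "mat n n (\<lambda>(s, t). if t = i then w s t else v s t)"
    have "det ?W = (\<Sum>m<n. ?W $$ (m, i) * cofactor ?W m i)"
      by (rule laplace_expansion_column) (use that in auto)
    moreover have "cofactor ?W m i = cofactor V m i" if "m < n" for m
      unfolding cofactor_def mat_delete_def V_def
      by (rule arg_cong2[of _ _ _ _ "(*)"], simp, rule arg_cong[of _ _ det], rule eq_matI)
        (use that \<open>i < n\<close> in auto)
    ultimately show ?thesis using that by simp
  qed
  \<comment> \<open>These are the entries of \<open>V * adj_mat V\<close>, which is
    \<open>det V\<close> times the identity.\<close>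
  have adj: "(\<Sum>i<n. v j i * cofactor V m i) = (if j = m then det V else 0)"
    if "j < n" "m < n" for j m
  proof -
    have "(V * adj_mat V) $$ (j, m) = (\<Sum>i<n. v j i * cofactor V m i)"
      using that by (simp add: V_def adj_mat_def scalar_prod_def atLeast0LessThan)
    then show ?thesis using adj_mat(2)[OF V] that by (cases "j = m") simp_all
  qed
  have "(\<Sum>i<n. g i * det (mat n n (\<lambda>(s, t). if t = i then w s t else v s t))) =
      (\<Sum>i<n. \<Sum>m<n. (g i * w m i) * cofactor V m i)"
    by (simp add: rep sum_distrib_left mult.assoc)
  also have "\<dots> = (\<Sum>i<n. \<Sum>m<n. \<Sum>j<n. A m j * (v j i * cofactor V m i))"
    by (intro sum.cong refl) (auto simp: A sum_distrib_right mult.assoc)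
  also have "\<dots> = (\<Sum>m<n. \<Sum>j<n. A m j * (\<Sum>i<n. v j i * cofactor V m i))"
    by (subst sum.swap, rule sum.cong[OF refl], subst sum.swap) (simp add: sum_distrib_left)
  also have "\<dots> = (\<Sum>m<n. \<Sum>j<n. A m j * (if j = m then det V else 0))"
    by (intro sum.cong refl) (simp add: adj)
  also have "\<dots> = (\<Sum>m<n. \<Sum>j<n. if j = m then A m m * det V else 0)"
    by (intro sum.cong refl) auto
  also have "\<dots> = (\<Sum>m<n. A m m) * det V"
    by (simp add: sum_distrib_right)
  finally show ?thesis by (simp add: V_def)
qed

text \<open>One coefficient function \<open>f\<close> serves all \<open>t\<close>, so it stands for
  the polynomial itself. By Vieta its top entry is minus the sum of the roots; this is how the shift
  by that sum enters the trace below.\<close>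

lemma prod_linear_factors_expand:
  fixes x :: "nat \<Rightarrow> 'a::comm_ring_1"
  shows "\<exists>f. (\<forall>t. (\<Prod>j<n. t - x j) = t ^ n + (\<Sum>k<n. f k * t ^ k)) \<and>
    (n > 0 \<longrightarrow> f (n - 1) = - (\<Sum>j<n. x j))"
proof (induction n)
  case 0
  show ?case by simp
next
  case (Suc n)
  then obtain f where f: "\<And>t. (\<Prod>j<n. t - x j) = t ^ n + (\<Sum>k<n. f k * t ^ k)"
    and top: "n > 0 \<Longrightarrow> f (n - 1) = - (\<Sum>j<n. x j)" by blast
  \<comment> \<open>Coefficients after multiplication by \<open>t - x n\<close>. The value 1 at
    \<open>k = n\<close> is the leading coefficient, which \<open>f\<close> does not store.\<close>
  define h where "h k = (if k = 0 then 0 else f (k - 1)) - x n * (if k = n then 1 else f k)" for k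
  have "(\<Prod>j<Suc n. t - x j) = t ^ Suc n + (\<Sum>k<Suc n. h k * t ^ k)" for t
  proof (cases n)
    case 0
    then show ?thesis by (simp add: h_def)
  next
    case (Suc m)
    have "(\<Sum>k<Suc n. h k * t ^ k) = h 0 + (\<Sum>k<n. h (Suc k) * t ^ Suc k)"
      by (simp add: sum.lessThan_Suc_shift del: sum.lessThan_Suc)
    also have "(\<Sum>k<n. h (Suc k) * t ^ Suc k) =
        (\<Sum>k<n. f k * t ^ Suc k) - (\<Sum>k<n. x n * (if Suc k = n then 1 else f (Suc k)) * t ^ Suc k)"
      by (simp add: h_def left_diff_distrib sum_subtractf)
    also have "(\<Sum>k<n. x n * (if Suc k = n then 1 else f (Suc k)) * t ^ Suc k) =
        x n * (\<Sum>k<m. f (Suc k) * t ^ Suc k) + x n * t ^ n"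
      by (simp add: Suc sum_distrib_left mult.assoc)
    also have "(\<Sum>k<m. f (Suc k) * t ^ Suc k) = (\<Sum>k<n. f k * t ^ k) - f 0"
      by (simp add: Suc sum.lessThan_Suc_shift del: sum.lessThan_Suc)
    finally have "(\<Sum>k<Suc n. h k * t ^ k) = h 0 + ((\<Sum>k<n. f k * t ^ Suc k) -
        (x n * ((\<Sum>k<n. f k * t ^ k) - f 0) + x n * t ^ n))" .
    moreover have "(\<Sum>k<n. f k * t ^ Suc k) = t * (\<Sum>k<n. f k * t ^ k)"
      by (simp add: sum_distrib_left mult_ac)
    moreover have "h 0 = - x n * f 0" using Suc by (simp add: h_def)
    ultimately show ?thesis by (simp add: f algebra_simps)
  qed
  moreover have "h n = - (\<Sum>j<Suc n. x j)"
    using top by (cases n) (auto simp: h_def)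
  ultimately show ?case by (intro exI[of _ h]) simp
qed

text \<open>Adding to the last row the multiples of earlier rows that turn \<open>t ^ n\<close> into
  \<open>\<Prod>j<n. t - z j\<close> leaves a last row that is zero except in column
  \<open>n\<close>. There is no division, so any commutative ring will do.\<close>

lemma vandermonde_Suc:
  fixes z :: "nat \<Rightarrow> 'a::comm_ring_1"
  shows "alternant [0..<Suc n] z = alternant [0..<n] z * (\<Prod>j<n. z n - z j)"
proof -
  obtain f where f: "\<And>t. (\<Prod>j<n. t - z j) = t ^ n + (\<Sum>k<n. f k * t ^ k)"
    using prod_linear_factors_expand[where n = n and x = z] by blast
  define M where "M = mat (Suc n) (Suc n) (\<lambda>(s, t). z t ^ s)"
  \<comment> \<open>The row operation as a lower unitriangular matrix, of determinant 1.\<close>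
  define L where "L = mat (Suc n) (Suc n) (\<lambda>(s, t). if s = t then 1 else if s = n then f t else 0)"
  have M: "M \<in> carrier_mat (Suc n) (Suc n)" and L: "L \<in> carrier_mat (Suc n) (Suc n)"
    by (simp_all add: M_def L_def)
  have "det L = prod_list (diag_mat L)"
    by (rule det_lower_triangular[OF _ L]) (auto simp: L_def)
  also have "\<dots> = 1"
    unfolding prod_list_diag_prod by (rule prod.neutral) (auto simp: L_def)
  finally have detL: "det L = 1" .
  have LM: "L * M = mat (Suc n) (Suc n)
      (\<lambda>(s, t). if s = n then \<Prod>j<n. z t - z j else z t ^ s)" (is "_ = ?N")
  proof (rule eq_matI)
    fix s t assume st: "s < dim_row ?N" "t < dim_col ?N"
    then have "(L * M) $$ (s, t) = (\<Sum>k<Suc n. L $$ (s, k) * M $$ (k, t))"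
      by (simp add: L_def M_def scalar_prod_def atLeast0LessThan del: sum.lessThan_Suc)
    also have "\<dots> = (\<Sum>k<Suc n. (if s = k then 1 else if s = n then f k else 0) * z t ^ k)"
      using st by (intro sum.cong refl) (auto simp: L_def M_def)
    also have "\<dots> = ?N $$ (s, t)"
    proof (cases "s = n")
      case True
      then show ?thesis using st by (simp add: f add.commute)
    next
      case False
      then have "(\<Sum>k<Suc n. (if s = k then 1 else if s = n then f k else 0) * z t ^ k) =
          (\<Sum>k<Suc n. if s = k then z t ^ k else 0)"
        by (intro sum.cong refl) auto
      then show ?thesis using False st by (simp del: sum.lessThan_Suc)
    qed
    finally show "(L * M) $$ (s, t) = ?N $$ (s, t)" .
  qed (auto simp: L_def M_def)
  have root: "(\<Prod>j<n. z t - z j) = 0" if "t < n" for t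
    using that by (intro prod_zero) auto
  have "det ?N = (\<Sum>t<Suc n. ?N $$ (n, t) * cofactor ?N n t)"
    by (rule laplace_expansion_row) auto
  also have "\<dots> = (\<Sum>t<Suc n. if t = n then (\<Prod>j<n. z n - z j) * cofactor ?N n n else 0)"
    by (intro sum.cong refl) (auto simp: less_Suc_eq root)
  also have "\<dots> = (\<Prod>j<n. z n - z j) * cofactor ?N n n" by simp
  also have "cofactor ?N n n = alternant [0..<n] z"
    unfolding cofactor_def alternant_def mat_delete_def
    by (simp, rule arg_cong[of _ _ det], rule eq_matI) auto
  finally have "det ?N = alternant [0..<n] z * (\<Prod>j<n. z n - z j)" by (simp add: mult.commute)
  moreover have "alternant [0..<Suc n] z = det M"
    unfolding alternant_def M_def by (rule arg_cong[of _ _ det], rule eq_matI) (auto simp del: upt_Suc)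
  moreover have "det M = det (L * M)" by (simp add: det_mult[OF L M] detL)
  ultimately show ?thesis using LM by simp
qed

text \<open>Column \<open>t\<close> has the common factor \<open>z t ^ k\<close>; in the Leibniz
  formula a permutation merely reorders these factors.\<close>

lemma alternant_shift:
  fixes z :: "nat \<Rightarrow> 'a::comm_ring_1"
  shows "alternant [k..<k + n] z = (\<Prod>t<n. z t ^ k) * alternant [0..<n] z"
proof -
  have "(\<Prod>s<n. z (\<sigma> s) ^ ([k..<k + n] ! s)) =
      (\<Prod>t<n. z t ^ k) * (\<Prod>s<n. z (\<sigma> s) ^ ([0..<n] ! s))"
    if "\<sigma> permutes {..<n}" for \<sigma>
  proof -
    have "(\<Prod>s<n. z (\<sigma> s) ^ ([k..<k + n] ! s)) =
        (\<Prod>s<n. z (\<sigma> s) ^ k) * (\<Prod>s<n. z (\<sigma> s) ^ ([0..<n] ! s))"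
      by (simp add: prod.distrib[symmetric] power_add)
    also have "(\<Prod>s<n. z (\<sigma> s) ^ k) = (\<Prod>t<n. z t ^ k)"
      using prod.permute[OF that, of "\<lambda>t. z t ^ k"] by (simp add: comp_def)
    finally show ?thesis .
  qed
  then show ?thesis
    by (auto simp: alternant_expand sum_distrib_left mult_ac intro!: sum.cong)
qed

text \<open>The map sending the column of powers of \<open>y i\<close> to \<open>g i\<close> times
  that of \<open>u i\<close> has matrix \<open>A\<close>, and the replacement sum is its trace times
  the alternant.\<close>

lemma sum_alternant_replace:
  fixes g u y :: "nat \<Rightarrow> 'a::comm_ring_1"
  assumes "\<And>i m. i < length es \<Longrightarrow> m < length es \<Longrightarrow>
    g i * u i ^ (es ! m) = (\<Sum>j<length es. A m j * y i ^ (es ! j))"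
  shows "(\<Sum>i<length es. g i * alternant es (y(i := u i))) = (\<Sum>m<length es. A m m) * alternant es y"
proof -
  have "alternant es (y(i := u i)) = det (mat (length es) (length es)
      (\<lambda>(s, t). if t = i then u t ^ (es ! s) else y t ^ (es ! s)))" for i
    unfolding alternant_def by (rule arg_cong[of _ _ det], rule eq_matI) auto
  then show ?thesis
    using sum_det_replace_column[of "length es" g "\<lambda>s t. u t ^ (es ! s)" A "\<lambda>s t. y t ^ (es ! s)"] assms
    by (simp add: alternant_def)
qed

section \<open>The defect of the n-Lie identity, and its trace form for consecutive
  exponents\<close>

text \<open>The indeterminates \<open>x\<close> belong to the arguments that define
  \<open>D\<close>, and \<open>y\<close> to those of the inner operation. The last entry of
  \<open>x\<close> is always overwritten, since \<open>D\<close> fixes one argument fewer.\<close>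

definition alternant_defect :: "nat list \<Rightarrow> (nat \<Rightarrow> 'a::comm_ring_1) \<Rightarrow> (nat \<Rightarrow> 'a) \<Rightarrow> 'a" where
  "alternant_defect es x y =
     alternant es (x(length es - 1 := \<Sum>i<length es. y i)) * alternant es y -
     (\<Sum>i<length es. alternant es (y(i := y i + (\<Sum>j<length es - 1. x j))) *
        alternant es (x(length es - 1 := y i)))"

text \<open>\<open>shift_rem n \<rho> s f m j\<close> is the coefficient of \<open>t\<^sup>j\<close> in \<open>(\<Sum>i<n. f i t\<^sup>i) (t + s)\<^sup>m\<close> modulo
  \<open>t\<^sup>n - (\<Sum>i<n. \<rho> i t\<^sup>i)\<close>.\<close>

fun shift_rem :: "nat \<Rightarrow> (nat \<Rightarrow> 'a::comm_ring_1) \<Rightarrow> 'a \<Rightarrow> (nat \<Rightarrow> 'a) \<Rightarrow> nat \<Rightarrow> nat \<Rightarrow> 'a" where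
  "shift_rem n \<rho> s f 0 j = f j"
| "shift_rem n \<rho> s f (Suc m) j = (if j = 0 then 0 else shift_rem n \<rho> s f m (j - 1)) +
     shift_rem n \<rho> s f m (n - 1) * \<rho> j + s * shift_rem n \<rho> s f m j"

text \<open>Multiplication by \<open>y + s\<close> shifts the coefficients up by one, reduces the
  overflow \<open>y ^ Suc n\<close> through \<open>root\<close>, and adds \<open>s\<close> times the
  old coefficients.\<close>

lemma shift_rem_eval:
  assumes root: "y ^ Suc n = (\<Sum>j<Suc n. \<rho> j * y ^ j)"
  shows "(\<Sum>j<Suc n. shift_rem (Suc n) \<rho> s f m j * y ^ j) = (\<Sum>j<Suc n. f j * y ^ j) * (y + s) ^ m"
proof (induction m)
  case 0
  show ?case by simp
next
  case (Suc m)
  let ?r = "shift_rem (Suc n) \<rho> s f m"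
  have "(\<Sum>j<Suc n. shift_rem (Suc n) \<rho> s f (Suc m) j * y ^ j) =
      (\<Sum>j<Suc n. (if j = 0 then 0 else ?r (j - 1)) * y ^ j) + ?r n * (\<Sum>j<Suc n. \<rho> j * y ^ j) +
      s * (\<Sum>j<Suc n. ?r j * y ^ j)"
    by (simp add: sum.distrib sum_distrib_left algebra_simps del: sum.lessThan_Suc)
  also have "(\<Sum>j<Suc n. (if j = 0 then 0 else ?r (j - 1)) * y ^ j) = y * (\<Sum>j<n. ?r j * y ^ j)"
    by (simp add: sum.lessThan_Suc_shift sum_distrib_left mult_ac del: sum.lessThan_Suc)
  also have "\<dots> + ?r n * (\<Sum>j<Suc n. \<rho> j * y ^ j) = y * (\<Sum>j<Suc n. ?r j * y ^ j)"
    unfolding root[symmetric] by (simp add: algebra_simps)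
  also have "\<dots> + s * (\<Sum>j<Suc n. ?r j * y ^ j) = (\<Sum>j<Suc n. f j * y ^ j) * (y + s) ^ Suc m"
    unfolding Suc by (simp add: algebra_simps del: sum.lessThan_Suc)
  finally show ?case .
qed

text \<open>The dependence on the last variable is isolated in one polynomial in \<open>t\<close>,
  namely the one whose multiplication map has its trace taken below.\<close>

lemma alternant_interval_last:
  fixes x :: "nat \<Rightarrow> 'a::comm_ring_1"
  shows "alternant [k..<k + Suc n] (x(n := t)) =
    (\<Prod>j<n. x j ^ k) * alternant [0..<n] x * (t ^ k * (\<Prod>j<n. t - x j))"
proof -
  have "alternant [0..<n] (x(n := t)) = alternant [0..<n] x"
    by (rule alternant_cong) simp
  then show ?thesis
    by (simp add: alternant_shift vandermonde_Suc mult_ac del: upt_Suc add_Suc_right)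
qed

text \<open>In the application \<open>f\<close> holds the coefficients of the product of the
  \<open>t - x j\<close>, and \<open>\<rho>\<close> those of \<open>t ^ Suc (Suc n)\<close> modulo
  the product of the \<open>t - y i\<close>; thus \<open>\<rho> (Suc n)\<close> is the sum of the
  \<open>y i\<close>, and \<open>s\<close> that of the \<open>x j\<close>. The defect is a multiple
  of the difference in \<open>trace\<close>, where these coefficients are free up to the two stated
  constraints.\<close>

lemma dvd_alternant_defect_interval:
  fixes x y :: "nat \<Rightarrow> 'a::comm_ring_1"
  assumes trace: "\<And>(f :: nat \<Rightarrow> 'a) \<rho> s. f (Suc n) = 1 \<Longrightarrow> f n = - s \<Longrightarrow>
    c dvd \<rho> (Suc n) ^ k * (\<Sum>j<Suc (Suc n). f j * \<rho> (Suc n) ^ j) -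
      (\<Sum>m<Suc (Suc n). shift_rem (Suc (Suc n)) \<rho> s f (k + m) m)"
  shows "c dvd alternant_defect [k..<k + Suc (Suc n)] x y"
proof -
  define s where "s = (\<Sum>j<Suc n. x j)"
  let ?N = "Suc (Suc n)" and ?es = "[k..<k + Suc (Suc n)]"
  obtain f0 where f0: "\<And>t. (\<Prod>j<Suc n. t - x j) = t ^ Suc n + (\<Sum>j<Suc n. f0 j * t ^ j)"
    and f0n: "f0 n = - s"
    using prod_linear_factors_expand[where n = "Suc n" and x = x] by (auto simp: s_def simp del: sum.lessThan_Suc)
  define f where "f j = (if j = Suc n then 1 else f0 j)" for j
  have f: "(\<Prod>j<Suc n. t - x j) = (\<Sum>j<?N. f j * t ^ j)" for t
  proof -
    have "(\<Sum>j<?N. f j * t ^ j) = (\<Sum>j<Suc n. f0 j * t ^ j) + t ^ Suc n"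
      by (subst sum.lessThan_Suc) (auto simp: f_def intro!: sum.cong)
    then show ?thesis by (simp only: f0 add.commute)
  qed
  obtain h where h: "\<And>t. (\<Prod>j<?N. t - y j) = t ^ ?N + (\<Sum>j<?N. h j * t ^ j)"
    and hn: "h (Suc n) = - (\<Sum>j<?N. y j)"
    using prod_linear_factors_expand[where n = ?N and x = y] by (auto simp del: sum.lessThan_Suc)
  define \<rho> where "\<rho> j = - h j" for j
  have root: "y i ^ ?N = (\<Sum>j<?N. \<rho> j * y i ^ j)" if "i < ?N" for i
  proof -
    have "(\<Prod>j<?N. y i - y j) = 0" using that by (intro prod_zero) auto
    then have "y i ^ ?N + (\<Sum>j<?N. h j * y i ^ j) = 0" by (simp only: h)
    moreover have "(\<Sum>j<?N. \<rho> j * y i ^ j) = - (\<Sum>j<?N. h j * y i ^ j)"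
      by (simp add: \<rho>_def sum_negf del: sum.lessThan_Suc)
    ultimately show ?thesis by (simp only: add_eq_0_iff2)
  qed
  define C where "C = (\<Prod>j<Suc n. x j ^ k) * alternant [0..<Suc n] x"
  have Q: "alternant ?es (x(Suc n := t)) = C * (t ^ k * (\<Sum>j<?N. f j * t ^ j))" for t
    using alternant_interval_last[of k "Suc n" x t] unfolding C_def f by simp
  let ?r = "\<lambda>m j. shift_rem ?N \<rho> s f (k + m) j"
  have len: "length ?es = ?N" by simp
  have "(\<Sum>i<length ?es. alternant ?es (x(Suc n := y i)) * alternant ?es (y(i := y i + s))) =
      (\<Sum>m<length ?es. C * ?r m m) * alternant ?es y"
  proof (rule sum_alternant_replace[where A = "\<lambda>m j. C * ?r m j"])
    fix i m assume "i < length ?es" "m < length ?es"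
    then have i: "i < ?N" and m: "m < ?N" by auto
    \<comment> \<open>The factor \<open>y i ^ k\<close> raises the powers from 0 on in the remainder
      to the powers from \<open>k\<close> on that the alternant contains.\<close>
    have "alternant ?es (x(Suc n := y i)) * (y i + s) ^ (?es ! m) =
        C * y i ^ k * ((\<Sum>j<?N. f j * y i ^ j) * (y i + s) ^ (k + m))"
      unfolding Q using m by (simp add: mult_ac del: upt_Suc sum.lessThan_Suc add_Suc_right)
    also have "\<dots> = C * y i ^ k * (\<Sum>j<?N. ?r m j * y i ^ j)"
      using shift_rem_eval[OF root[OF i]] by (simp only:)
    also have "\<dots> = (\<Sum>j<?N. C * ?r m j * y i ^ (k + j))"
      by (simp add: sum_distrib_left power_add mult_ac del: sum.lessThan_Suc)
    also have "\<dots> = (\<Sum>j<length ?es. C * ?r m j * y i ^ (?es ! j))"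
      by (intro sum.cong) (auto simp del: upt_Suc)
    finally show "alternant ?es (x(Suc n := y i)) * (y i + s) ^ (?es ! m) =
      (\<Sum>j<length ?es. C * ?r m j * y i ^ (?es ! j))" .
  qed
  then have S: "(\<Sum>i<?N. alternant ?es (y(i := y i + s)) * alternant ?es (x(Suc n := y i))) =
      C * (\<Sum>m<?N. ?r m m) * alternant ?es y"
    unfolding len by (simp add: sum_distrib_left mult.commute del: sum.lessThan_Suc upt_Suc)
  have "alternant_defect ?es x y = C * alternant ?es y *
      (\<rho> (Suc n) ^ k * (\<Sum>j<?N. f j * \<rho> (Suc n) ^ j) - (\<Sum>m<?N. ?r m m))"
  proof -
    have "\<rho> (Suc n) = (\<Sum>j<?N. y j)" by (simp add: \<rho>_def hn)
    then show ?thesis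
      unfolding alternant_defect_def len diff_Suc_1 s_def[symmetric] S
      unfolding Q
      by (simp add: algebra_simps del: sum.lessThan_Suc upt_Suc add_Suc_right)
  qed
  moreover have "f (Suc n) = 1" "f n = - s" by (simp_all add: f_def f0n)
  ultimately show ?thesis using trace[of f s \<rho>] by simp
qed

text \<open>Expanding the five remainders leaves a polynomial identity in the free coefficients; the
  witness is the trace difference divided by 2.\<close>

lemma dvd_alternant_defect_01234:
  fixes x y :: "nat \<Rightarrow> 'a::comm_ring_1"
  shows "2 dvd alternant_defect [0, 1, 2, 3, 4] x y"
proof -
  have "2 dvd alternant_defect [0..<0 + Suc (Suc 3)] x y"
  proof (rule dvd_alternant_defect_interval)
    fix f \<rho> :: "nat \<Rightarrow> 'a" and s :: 'a
    assume "f (Suc 3) = 1" "f 3 = - s"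
    then show "2 dvd \<rho> (Suc 3) ^ 0 * (\<Sum>j<Suc (Suc 3). f j * \<rho> (Suc 3) ^ j) -
      (\<Sum>m<Suc (Suc 3). shift_rem (Suc (Suc 3)) \<rho> s f (0 + m) m)"
      by (intro dvdI[of _ _ "- 2 * f 0 - 5 * f 1 * s - f 2 * \<rho> 3 - 2 * f 2 * \<rho> 4 * s
          - 5 * f 2 * s^2 - 2 * \<rho> 1 - 2 * \<rho> 2 * \<rho> 4 - 3 * \<rho> 2 * s
          - 4 * \<rho> 3 * \<rho> 4 * s - 2 * \<rho> 3 * \<rho> 4^2 - \<rho> 3 * s^2
          - \<rho> 3^2 + \<rho> 4 * s^3 - \<rho> 4^2 * s^2 - 2 * \<rho> 4^3 * s
          + 2 * s^4"]) (simp add: eval_nat_numeral algebra_simps)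
  qed
  then show ?thesis by (simp add: upt_rec eval_nat_numeral)
qed

text \<open>The quotient is the one for exponents 0 to 4 with all indices lowered by one, terms with
  a negative index being dropped.\<close>

lemma dvd_alternant_defect_1234:
  fixes x y :: "nat \<Rightarrow> 'a::comm_ring_1"
  shows "2 dvd alternant_defect [1, 2, 3, 4] x y"
proof -
  have "2 dvd alternant_defect [1..<1 + Suc (Suc 2)] x y"
  proof (rule dvd_alternant_defect_interval)
    fix f \<rho> :: "nat \<Rightarrow> 'a" and s :: 'a
    assume "f (Suc 2) = 1" "f 2 = - s"
    then show "2 dvd \<rho> (Suc 2) ^ 1 * (\<Sum>j<Suc (Suc 2). f j * \<rho> (Suc 2) ^ j) -
      (\<Sum>m<Suc (Suc 2). shift_rem (Suc (Suc 2)) \<rho> s f (1 + m) m)"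
      by (intro dvdI[of _ _ "- 5 * f 0 * s - f 1 * \<rho> 2 - 2 * f 1 * \<rho> 3 * s
          - 5 * f 1 * s^2 - 2 * \<rho> 0 - 2 * \<rho> 1 * \<rho> 3 - 3 * \<rho> 1 * s
          - 4 * \<rho> 2 * \<rho> 3 * s - 2 * \<rho> 2 * \<rho> 3^2 - \<rho> 2 * s^2
          - \<rho> 2^2 + \<rho> 3 * s^3 - \<rho> 3^2 * s^2 - 2 * \<rho> 3^3 * s
          + 2 * s^4"]) (simp add: eval_nat_numeral algebra_simps)
  qed
  then show ?thesis by (simp add: upt_rec eval_nat_numeral)
qed

text \<open>The quotient arises by lowering the indices once more in the same way.\<close>

lemma dvd_alternant_defect_234:
  fixes x y :: "nat \<Rightarrow> 'a::comm_ring_1"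
  shows "2 dvd alternant_defect [2, 3, 4] x y"
proof -
  have "2 dvd alternant_defect [2..<2 + Suc (Suc 1)] x y"
  proof (rule dvd_alternant_defect_interval)
    fix f \<rho> :: "nat \<Rightarrow> 'a" and s :: 'a
    assume "f (Suc 1) = 1" "f 1 = - s"
    then show "2 dvd \<rho> (Suc 1) ^ 2 * (\<Sum>j<Suc (Suc 1). f j * \<rho> (Suc 1) ^ j) -
      (\<Sum>m<Suc (Suc 1). shift_rem (Suc (Suc 1)) \<rho> s f (2 + m) m)"
      by (intro dvdI[of _ _ "- f 0 * \<rho> 1 - 2 * f 0 * \<rho> 2 * s - 5 * f 0 * s^2
          - 2 * \<rho> 0 * \<rho> 2 - 3 * \<rho> 0 * s - 4 * \<rho> 1 * \<rho> 2 * s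
          - 2 * \<rho> 1 * \<rho> 2^2 - \<rho> 1 * s^2 - \<rho> 1^2 + \<rho> 2 * s^3
          - \<rho> 2^2 * s^2 - 2 * \<rho> 2^3 * s
          + 2 * s^4"]) (simp add: eval_nat_numeral algebra_simps)
  qed
  then show ?thesis by (simp add: upt_rec eval_nat_numeral)
qed

text \<open>The same computation with four remainders; the trace difference is now divisible by
  3.\<close>

lemma dvd_alternant_defect_0123:
  fixes x y :: "nat \<Rightarrow> 'a::comm_ring_1"
  shows "3 dvd alternant_defect [0, 1, 2, 3] x y"
proof -
  have "3 dvd alternant_defect [0..<0 + Suc (Suc 2)] x y"
  proof (rule dvd_alternant_defect_interval)
    fix f \<rho> :: "nat \<Rightarrow> 'a" and s :: 'a
    assume "f (Suc 2) = 1" "f 2 = - s"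
    then show "3 dvd \<rho> (Suc 2) ^ 0 * (\<Sum>j<Suc (Suc 2). f j * \<rho> (Suc 2) ^ j) -
      (\<Sum>m<Suc (Suc 2). shift_rem (Suc (Suc 2)) \<rho> s f (0 + m) m)"
      by (intro dvdI[of _ _ "- f 0 - 2 * f 1 * s - \<rho> 1 - \<rho> 2 * \<rho> 3 - \<rho> 2 * s
          - \<rho> 3^2 * s + s^3"]) (simp add: eval_nat_numeral algebra_simps)
  qed
  then show ?thesis by (simp add: upt_rec eval_nat_numeral)
qed

text \<open>Again the indices in the previous quotient are lowered by one and the term of negative
  index is dropped.\<close>

lemma dvd_alternant_defect_123:
  fixes x y :: "nat \<Rightarrow> 'a::comm_ring_1"
  shows "3 dvd alternant_defect [1, 2, 3] x y"
proof -
  have "3 dvd alternant_defect [1..<1 + Suc (Suc 1)] x y"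
  proof (rule dvd_alternant_defect_interval)
    fix f \<rho> :: "nat \<Rightarrow> 'a" and s :: 'a
    assume "f (Suc 1) = 1" "f 1 = - s"
    then show "3 dvd \<rho> (Suc 1) ^ 1 * (\<Sum>j<Suc (Suc 1). f j * \<rho> (Suc 1) ^ j) -
      (\<Sum>m<Suc (Suc 1). shift_rem (Suc (Suc 1)) \<rho> s f (1 + m) m)"
      by (intro dvdI[of _ _ "- 2 * f 0 * s - \<rho> 0 - \<rho> 1 * \<rho> 2 - \<rho> 1 * s
          - \<rho> 2^2 * s + s^3"]) (simp add: eval_nat_numeral algebra_simps)
  qed
  then show ?thesis by (simp add: upt_rec eval_nat_numeral)
qed

section \<open>Small alternants, the Frobenius map, and exponents tied to powers of 2 and 3\<close>

lemma alternant_Cons: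
  fixes z :: "nat \<Rightarrow> 'a::comm_ring_1"
  shows "alternant (e # es) z =
    (\<Sum>t<Suc (length es). (- 1) ^ t * z t ^ e * alternant es (\<lambda>j. z (if j < t then j else Suc j)))"
proof -
  let ?n = "Suc (length es)"
  let ?M = "mat ?n ?n (\<lambda>(s, t). z t ^ ((e # es) ! s))"
  have "det ?M = (\<Sum>t<?n. ?M $$ (0, t) * cofactor ?M 0 t)"
    by (rule laplace_expansion_row) auto
  moreover have "cofactor ?M 0 t = (- 1) ^ t * alternant es (\<lambda>j. z (if j < t then j else Suc j))"
    if "t < ?n" for t
    unfolding cofactor_def alternant_def mat_delete_def
    by (rule arg_cong2[of _ _ _ _ "(*)"], simp, rule arg_cong[of _ _ det], rule eq_matI) (use that in auto)
  ultimately show ?thesis unfolding alternant_def by (simp add: mult_ac del: sum.lessThan_Suc)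
qed

lemma alternant_Nil [simp]: "alternant [] z = 1"
  by (simp add: alternant_def)

lemma alternant_2: "alternant [a, b] z = z 0 ^ a * z 1 ^ b - z 1 ^ a * z 0 ^ b"
  by (simp add: alternant_Cons eval_nat_numeral)

lemma alternant_3:
  "alternant [a, b, c] z =
     z 0 ^ a * (z 1 ^ b * z 2 ^ c - z 2 ^ b * z 1 ^ c) -
     z 1 ^ a * (z 0 ^ b * z 2 ^ c - z 2 ^ b * z 0 ^ c) +
     z 2 ^ a * (z 0 ^ b * z 1 ^ c - z 1 ^ b * z 0 ^ c)"
  by (simp add: alternant_Cons eval_nat_numeral algebra_simps)

text \<open>Laplace expansion along column \<open>i\<close>: in a single variable only the powers
  listed in \<open>es\<close> occur. If all of these are powers of 2, the alternant is additive in
  that variable modulo 2.\<close>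

lemma alternant_column:
  fixes z :: "nat \<Rightarrow> 'a::comm_ring_1"
  assumes "i < length es"
  shows "\<exists>c. \<forall>t. alternant es (z(i := t)) = (\<Sum>m<length es. c m * t ^ (es ! m))"
proof -
  let ?n = "length es"
  let ?M = "\<lambda>t. mat ?n ?n (\<lambda>(s, j). (z(i := t)) j ^ (es ! s))"
  \<comment> \<open>The value 0 in column \<open>i\<close> is arbitrary, as the cofactors delete
    this column.\<close>
  define c where "c m = cofactor (?M 0) m i" for m
  have "alternant es (z(i := t)) = (\<Sum>m<?n. ?M t $$ (m, i) * cofactor (?M t) m i)" for t
    unfolding alternant_def by (rule laplace_expansion_column) (use assms in auto)
  moreover have "cofactor (?M t) m i = c m" if "m < ?n" for m t
    unfolding c_def cofactor_def mat_delete_def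
    by (rule arg_cong2[of _ _ _ _ "(*)"], simp, rule arg_cong[of _ _ det], rule eq_matI)
      (use that assms in auto)
  ultimately show ?thesis using assms
    by (intro exI[of _ c]) (simp add: mult.commute)
qed

text \<open>The square of \<open>A + B + 2 * h\<close> is again \<open>A^2 + B^2\<close> up to an
  even term. Additivity of Frobenius appears as a divisibility because the symbols are integer
  polynomials.\<close>

lemma freshman_dvd_2:
  fixes a b :: "'a::comm_ring_1"
  shows "2 dvd (a + b) ^ (2 ^ k) - (a ^ (2 ^ k) + b ^ (2 ^ k))"
proof (induction k)
  case 0
  show ?case by simp
next
  case (Suc k)
  define A B where "A = a ^ (2 ^ k)" and "B = b ^ (2 ^ k)"
  obtain h where h: "(a + b) ^ (2 ^ k) = A + B + 2 * h"
    using Suc unfolding A_def B_def dvd_def by (metis diff_eq_eq add.commute)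
  have p: "x ^ (2 ^ Suc k) = (x ^ (2 ^ k))^2" for x :: 'a
    by (simp add: power_mult[symmetric] mult.commute)
  show ?case unfolding p h A_def[symmetric] B_def[symmetric]
    by (intro dvdI[of _ _ "A * B + 2 * h * (A + B) + 2 * h^2"])
      (simp add: power2_eq_square algebra_simps)
qed

lemma freshman_dvd_3:
  fixes a b :: "'a::comm_ring_1"
  shows "3 dvd (a + b) ^ (3 ^ k) - (a ^ (3 ^ k) + b ^ (3 ^ k))"
proof (induction k)
  case 0
  show ?case by simp
next
  case (Suc k)
  define A B where "A = a ^ (3 ^ k)" and "B = b ^ (3 ^ k)"
  obtain h where h: "(a + b) ^ (3 ^ k) = A + B + 3 * h"
    using Suc unfolding A_def B_def dvd_def by (metis diff_eq_eq add.commute)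
  have p: "x ^ (3 ^ Suc k) = (x ^ (3 ^ k)) ^ 3" for x :: 'a
    by (simp add: power_mult[symmetric] mult.commute)
  show ?case unfolding p h A_def[symmetric] B_def[symmetric]
    by (intro dvdI[of _ _ "A^2 * B + A * B^2 + 3 * h * (A + B)^2 + 9 * h^2 * (A + B) + 9 * h ^ 3"])
      (simp add: power2_eq_square power3_eq_cube algebra_simps)
qed

lemma alternant_defect_2:
  "alternant_defect [a, b] x y =
     (x 0 ^ a * (y 0 + y 1) ^ b - (y 0 + y 1) ^ a * x 0 ^ b) * (y 0 ^ a * y 1 ^ b - y 1 ^ a * y 0 ^ b) -
     ((y 0 + x 0) ^ a * y 1 ^ b - y 1 ^ a * (y 0 + x 0) ^ b) * (x 0 ^ a * y 0 ^ b - y 0 ^ a * x 0 ^ b) -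
     (y 0 ^ a * (y 1 + x 0) ^ b - (y 1 + x 0) ^ a * y 0 ^ b) * (x 0 ^ a * y 1 ^ b - y 1 ^ a * x 0 ^ b)"
  unfolding alternant_defect_def by (simp add: alternant_2 eval_nat_numeral)

text \<open>Here the defect vanishes identically: \<open>u * d v - v * d u\<close> is the
  coefficient in the commutator of the derivations \<open>u * d\<close> and
  \<open>v * d\<close>.\<close>

lemma alternant_defect_01: "alternant_defect [0, 1] (x :: nat \<Rightarrow> 'a::comm_ring_1) y = 0"
  by (simp add: alternant_defect_2 algebra_simps)

text \<open>With \<open>m = 2 ^ l\<close> the exponents are \<open>m * w\<close> and
  \<open>m * Suc w\<close>, and raising to the power \<open>m\<close> or \<open>2 ^ r\<close> is
  additive modulo 2. After the powers with exponent \<open>w\<close> are factored out, each of the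
  three terms contains \<open>G\<close> modulo 2, and the cofactors of \<open>G\<close> add up to an
  even element.\<close>

lemma dvd_alternant_defect_power2:
  fixes x y :: "nat \<Rightarrow> 'a::comm_ring_1"
  assumes "l \<le> r"
  shows "2 dvd alternant_defect [2 ^ r - 2 ^ l, 2 ^ r] x y"
proof -
  define m w :: nat where "m = 2 ^ l" and "w = 2 ^ (r - l) - 1"
  have S: "2 ^ (r - l) = Suc w" by (simp add: w_def)
  have r: "(2::nat) ^ r = m * Suc w"
    unfolding m_def S[symmetric] using assms by (simp flip: power_add)
  have rl: "2 ^ r - 2 ^ l = m * w" unfolding r by (simp add: m_def)
  define X0 Y0 Y1 where "X0 = x 0 ^ m" and "Y0 = y 0 ^ m" and "Y1 = y 1 ^ m"
  define a b c where "a = (y 0 + y 1) ^ m" and "b = (y 0 + x 0) ^ m" and "c = (y 1 + x 0) ^ m"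
  have fr: "\<exists>h. (u + v) ^ m = u ^ m + v ^ m + 2 * h" for u v :: 'a
    using freshman_dvd_2[of u v l] unfolding m_def dvd_def by (metis diff_eq_eq add.commute)
  have frS: "\<exists>h. ((u + v) ^ m) ^ w * (u + v) ^ m = (u ^ m) ^ w * u ^ m + (v ^ m) ^ w * v ^ m + 2 * h"
    for u v :: 'a
  proof -
    have "(t ^ m) ^ w * t ^ m = t ^ (2 ^ r)" for t :: 'a
      unfolding r by (simp add: power_mult power_add mult.commute)
    then show ?thesis
      using freshman_dvd_2[of u v r] unfolding dvd_def by (metis diff_eq_eq add.commute)
  qed
  obtain h1 h2 h3 where h: "a = Y0 + Y1 + 2 * h1" "b = Y0 + X0 + 2 * h2" "c = Y1 + X0 + 2 * h3"
    unfolding a_def b_def c_def X0_def Y0_def Y1_def using fr by metis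
  obtain k1 k2 k3 where k: "a ^ w * a = Y0 ^ w * Y0 + Y1 ^ w * Y1 + 2 * k1"
    "b ^ w * b = Y0 ^ w * Y0 + X0 ^ w * X0 + 2 * k2" "c ^ w * c = Y1 ^ w * Y1 + X0 ^ w * X0 + 2 * k3"
    unfolding a_def b_def c_def X0_def Y0_def Y1_def using frS by metis
  \<comment> \<open>\<open>G\<close> is the common value modulo 2 of \<open>a - X0\<close>,
    \<open>Y1 - b\<close> and \<open>c - Y0\<close>; the \<open>e\<close> with odd index record the
    even errors.\<close>
  define G where "G = X0 + Y0 + Y1"
  define e1 e3 e5 where "e1 = h1 - X0" and "e3 = - Y0 - X0 - h2" and "e5 = h3 - Y0"
  define e2 e4 e6 where "e2 = k1 - a ^ w * (h1 + Y0)" and "e4 = k2 - b ^ w * (h2 + X0)"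
    and "e6 = k3 - c ^ w * (h3 + X0)"
  have e: "a - X0 = G + 2 * e1" "Y1 - b = G + 2 * e3" "c - Y0 = G + 2 * e5"
    by (simp_all add: h e1_def e3_def e5_def G_def)
  \<comment> \<open>Modulo 2 the difference \<open>Y1 - Y0\<close> is \<open>a\<close>, so the
    product is a power with exponent \<open>2 ^ r\<close> and Frobenius applies once more. Only the
    single factor \<open>a\<close> is expanded, the powers \<open>a ^ w\<close> are kept.\<close>
  have "a ^ w * (Y1 - Y0) = a ^ w * a - 2 * (a ^ w * (h1 + Y0))"
    by (subst (3) h(1)) (simp add: algebra_simps)
  moreover have "b ^ w * (Y0 - X0) = b ^ w * b - 2 * (b ^ w * (h2 + X0))"
    by (subst (3) h(2)) (simp add: algebra_simps)
  moreover have "c ^ w * (Y1 - X0) = c ^ w * c - 2 * (c ^ w * (h3 + X0))"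
    by (subst (3) h(3)) (simp add: algebra_simps)
  ultimately have e': "a ^ w * (Y1 - Y0) = Y0 ^ w * Y0 + Y1 ^ w * Y1 + 2 * e2"
    "b ^ w * (Y0 - X0) = Y0 ^ w * Y0 + X0 ^ w * X0 + 2 * e4"
    "c ^ w * (Y1 - X0) = Y1 ^ w * Y1 + X0 ^ w * X0 + 2 * e6"
    unfolding k e2_def e4_def e6_def by (simp_all only: right_diff_distrib add_diff_eq)
  have "alternant_defect [2 ^ r - 2 ^ l, 2 ^ r] x y = X0 ^ w * Y0 ^ w * Y1 ^ w *
      ((a - X0) * (a ^ w * (Y1 - Y0)) - (Y1 - b) * (b ^ w * (Y0 - X0)) - (c - Y0) * (c ^ w * (Y1 - X0)))"
    unfolding rl unfolding r alternant_defect_2 power_mult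
    unfolding X0_def[symmetric] Y0_def[symmetric] Y1_def[symmetric]
      a_def[symmetric] b_def[symmetric] c_def[symmetric]
    by (simp add: algebra_simps)
  also have "\<dots> = 2 * (X0 ^ w * Y0 ^ w * Y1 ^ w * (- G * X0 ^ w * X0 +
      e1 * (Y0 ^ w * Y0 + Y1 ^ w * Y1 + 2 * e2) + G * e2 -
      e3 * (Y0 ^ w * Y0 + X0 ^ w * X0 + 2 * e4) - G * e4 -
      e5 * (Y1 ^ w * Y1 + X0 ^ w * X0 + 2 * e6) - G * e6))"
    unfolding e e' by (simp add: algebra_simps)
  finally show ?thesis by simp
qed

text \<open>Additivity of the power \<open>3 ^ r\<close> modulo 3 reduces the claim to exponents 2
  and 3 in \<open>X0\<close>, \<open>Y0\<close>, \<open>Y1\<close>.\<close>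

lemma dvd_alternant_defect_power3:
  fixes x y :: "nat \<Rightarrow> 'a::comm_ring_1"
  shows "3 dvd alternant_defect [2 * 3 ^ r, 3 ^ (r + 1)] x y"
proof -
  define q :: nat where "q = 3 ^ r"
  have q: "3 ^ (r + 1) = q * 3" "2 * 3 ^ r = q * 2" by (simp_all add: q_def)
  define X0 Y0 Y1 where "X0 = x 0 ^ q" and "Y0 = y 0 ^ q" and "Y1 = y 1 ^ q"
  define a b c where "a = (y 0 + y 1) ^ q" and "b = (y 0 + x 0) ^ q" and "c = (y 1 + x 0) ^ q"
  have fr: "\<exists>h. (u + v) ^ q = u ^ q + v ^ q + 3 * h" for u v :: 'a
    using freshman_dvd_3[of u v r] unfolding q_def dvd_def by (metis diff_eq_eq add.commute)
  obtain h1 h2 h3 where h: "a = Y0 + Y1 + 3 * h1" "b = Y0 + X0 + 3 * h2" "c = Y1 + X0 + 3 * h3"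
    unfolding a_def b_def c_def X0_def Y0_def Y1_def using fr by metis
  \<comment> \<open>The quotient by 3 of the reduced defect, including the error terms
    \<open>h1\<close>, \<open>h2\<close>, \<open>h3\<close> of Frobenius.\<close>
  define H where "H = 3 * X0 * Y0 * h1^2 - 3 * X0 * Y0 * h3^2 + 2 * X0 * Y0^2 * h1
      + 3 * X0 * Y0^2 * h2 + X0 * Y0^3 - 3 * X0 * Y1 * h1^2 + 3 * X0 * Y1 * h2^2
      - 2 * X0 * Y1^2 * h1 - 3 * X0 * Y1^2 * h3 - X0 * Y1^3 - 9 * X0 * h2^3 + 9 * X0 * h3^3
      - 3 * X0^2 * Y0 * h2 - 2 * X0^2 * Y0 * h3 + 2 * X0^2 * Y1 * h2 + 3 * X0^2 * Y1 * h3
      - 9 * X0^2 * h2^2 + 9 * X0^2 * h3^2 - X0^3 * Y0 + X0^3 * Y1 - 3 * X0^3 * h2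
      + 3 * X0^3 * h3 - 3 * Y0 * Y1 * h2^2 + 3 * Y0 * Y1 * h3^2 + 3 * Y0 * Y1^2 * h1
      + 2 * Y0 * Y1^2 * h3 + Y0 * Y1^3 - 9 * Y0 * h1^3 + 9 * Y0 * h2^3 - 3 * Y0^2 * Y1 * h1
      - 2 * Y0^2 * Y1 * h2 - 9 * Y0^2 * h1^2 + 9 * Y0^2 * h2^2 - Y0^3 * Y1 - 3 * Y0^3 * h1
      + 3 * Y0^3 * h2 + 9 * Y1 * h1^3 - 9 * Y1 * h3^3 + 9 * Y1^2 * h1^2 - 9 * Y1^2 * h3^2
      + 3 * Y1^3 * h1 - 3 * Y1^3 * h3"
  have "alternant_defect [2 * 3 ^ r, 3 ^ (r + 1)] x y = X0^2 * Y0^2 * Y1^2 *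
      (a^2 * (a - X0) * (Y1 - Y0) - b^2 * (Y1 - b) * (Y0 - X0) - c^2 * (c - Y0) * (Y1 - X0))"
    unfolding q alternant_defect_2 power_mult
    unfolding X0_def[symmetric] Y0_def[symmetric] Y1_def[symmetric]
      a_def[symmetric] b_def[symmetric] c_def[symmetric]
    by (simp add: power2_eq_square power3_eq_cube algebra_simps)
  also have "a^2 * (a - X0) * (Y1 - Y0) - b^2 * (Y1 - b) * (Y0 - X0) - c^2 * (c - Y0) * (Y1 - X0) =
      3 * H"
    unfolding h H_def by (simp add: eval_nat_numeral algebra_simps)
  finally have *: "alternant_defect [2 * 3 ^ r, 3 ^ (r + 1)] x y = X0^2 * Y0^2 * Y1^2 * (3 * H)" .
  show ?thesis unfolding * by (intro dvd_mult dvd_triv_left)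
qed

text \<open>By additivity modulo 2, replacing \<open>y i\<close> by \<open>y i + s\<close> splits
  each term in two. The parts with \<open>alt y\<close> add up to
  \<open>Q (y 0 + y 1 + y 2) * alt y\<close> and cancel the leading term; the parts with
  \<open>s\<close> add up to \<open>Q s * alt y\<close> by Cramer's rule, and \<open>Q s\<close> is
  even.\<close>

lemma dvd_alternant_defect_124:
  fixes x y :: "nat \<Rightarrow> 'a::comm_ring_1"
  shows "2 dvd alternant_defect [1, 2, 4] x y"
proof -
  define alt :: "(nat \<Rightarrow> 'a) \<Rightarrow> 'a" where "alt = alternant [1, 2, 4]"
  have col: "\<exists>c0 c1 c2. \<forall>t. alt (z(i := t)) = c0 * t + c1 * t ^ 2 + c2 * t ^ 4" if "i < 3" for z i
    using alternant_column[of i "[1, 2, 4]" z] that unfolding alt_def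
    by (simp add: eval_nat_numeral) blast
  have add: "\<exists>h. alt (z(i := a + b)) = alt (z(i := a)) + alt (z(i := b)) + 2 * h" if i: "i < 3" for z i a b
  proof -
    obtain c0 c1 c2 where c: "\<And>t. alt (z(i := t)) = c0 * t + c1 * t ^ 2 + c2 * t ^ 4"
      using col[OF i, of z] by blast
    show ?thesis unfolding c
      by (rule exI[of _ "c1 * a * b + c2 * (2 * a^3 * b + 3 * a^2 * b^2 + 2 * a * b^3)"]) (simp add: eval_nat_numeral algebra_simps)
  qed
  define s where "s = x 0 + x 1"
  define Q where "Q t = alt (x(2 := t))" for t
  obtain c0 c1 c2 where c: "\<And>t. Q t = c0 * t + c1 * t ^ 2 + c2 * t ^ 4"
    unfolding Q_def using col[of 2 x] by auto
  \<comment> \<open>A matrix of rank one: the coefficients of \<open>Q\<close> times the powers of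
    \<open>s\<close>. Its trace is \<open>Q s\<close>.\<close>
  define A where "A m j = (if j = 0 then c0 else if j = 1 then c1 else c2) * s ^ ([1, 2, 4] ! m)"
    for m j :: nat
  have "(\<Sum>i<length [1, 2, 4::nat]. Q (y i) * alternant [1, 2, 4] (y(i := s))) =
      (\<Sum>m<length [1, 2, 4::nat]. A m m) * alternant [1, 2, 4] y"
    by (rule sum_alternant_replace[where A = A])
      (auto simp: A_def c eval_nat_numeral algebra_simps)
  then have cramer: "Q (y 0) * alt (y(0 := s)) + Q (y 1) * alt (y(1 := s)) + Q (y 2) * alt (y(2 := s)) =
      Q s * alt y"
    by (simp add: A_def c alt_def eval_nat_numeral algebra_simps)
  \<comment> \<open>Since \<open>s = x 0 + x 1\<close>, additivity modulo 2 reduces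
    \<open>Q s\<close> to two alternants with a repeated variable.\<close>
  have "2 dvd Q s"
    unfolding Q_def alt_def s_def alternant_3
    by (rule dvdI[of _ _ "x 0^2 * x 1^5 + x 0^3 * x 1^4 - x 0^4 * x 1^3
        - x 0^5 * x 1^2"]) (simp add: eval_nat_numeral algebra_simps)
  then obtain k0 where k0: "Q s = 2 * k0" by blast
  obtain k1 where k1: "Q (y 0 + y 1 + y 2) = Q (y 0 + y 1) + Q (y 2) + 2 * k1"
    unfolding Q_def using add[of 2 x "y 0 + y 1" "y 2"] by auto
  obtain k2 where k2: "Q (y 0 + y 1) = Q (y 0) + Q (y 1) + 2 * k2"
    unfolding Q_def using add[of 2 x "y 0" "y 1"] by auto
  have "\<forall>i<3. \<exists>h. alt (y(i := y i + s)) = alt (y(i := y i)) + alt (y(i := s)) + 2 * h"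
    using add by blast
  then obtain h where h: "\<And>i. i < 3 \<Longrightarrow> alt (y(i := y i + s)) = alt y + alt (y(i := s)) + 2 * h i"
    unfolding fun_upd_triv by metis
  have hs: "alt (y(0 := y 0 + s)) = alt y + alt (y(0 := s)) + 2 * h 0"
    "alt (y(1 := y 1 + s)) = alt y + alt (y(1 := s)) + 2 * h 1"
    "alt (y(2 := y 2 + s)) = alt y + alt (y(2 := s)) + 2 * h 2"
    by (rule h, simp)+
  have "alternant_defect [1, 2, 4] x y = Q (y 0 + y 1 + y 2) * alt y -
      (alt (y(0 := y 0 + s)) * Q (y 0) + alt (y(1 := y 1 + s)) * Q (y 1) + alt (y(2 := y 2 + s)) * Q (y 2))"
    unfolding alternant_defect_def Q_def alt_def s_def by (simp add: eval_nat_numeral)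
  also have "\<dots> = (2 * k1 + 2 * k2) * alt y - 2 * (h 0 * Q (y 0) + h 1 * Q (y 1) + h 2 * Q (y 2)) -
      (Q (y 0) * alt (y(0 := s)) + Q (y 1) * alt (y(1 := s)) + Q (y 2) * alt (y(2 := s)))"
    unfolding hs k1 k2 by (simp add: algebra_simps)
  also have "\<dots> = 2 * ((k1 + k2 - k0) * alt y - (h 0 * Q (y 0) + h 1 * Q (y 1) + h 2 * Q (y 2)))"
    unfolding cramer k0 by (simp add: algebra_simps)
  finally show ?thesis by simp
qed

section \<open>Differential polynomials\<close>

definition indet :: "nat \<Rightarrow> (nat \<Rightarrow>\<^sub>0 nat) \<Rightarrow>\<^sub>0 int" where
  "indet j = Poly_Mapping.single (Poly_Mapping.single j 1) 1"

definition vars_in :: "((nat \<Rightarrow>\<^sub>0 nat) \<Rightarrow>\<^sub>0 int) \<Rightarrow> nat set \<Rightarrow> bool" where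
  "vars_in P A \<longleftrightarrow> (\<forall>m\<in>Poly_Mapping.keys P. Poly_Mapping.keys m \<subseteq> A)"

lemma vars_in_mono: "vars_in P A \<Longrightarrow> A \<subseteq> B \<Longrightarrow> vars_in P B"
  by (auto simp: vars_in_def)

lemma vars_in_add: "vars_in P A \<Longrightarrow> vars_in Q A \<Longrightarrow> vars_in (P + Q) A"
  using keys_add[of P Q] by (auto simp: vars_in_def)

lemma vars_in_uminus: "vars_in P A \<Longrightarrow> vars_in (- P) A"
  by (auto simp: vars_in_def in_keys_iff)

lemma vars_in_mult:
  assumes "vars_in P A" "vars_in Q A"
  shows "vars_in (P * Q) A"
  unfolding vars_in_def
proof
  fix m assume "m \<in> Poly_Mapping.keys (P * Q)"
  then obtain a b where "m = a + b" "a \<in> Poly_Mapping.keys P" "b \<in> Poly_Mapping.keys Q"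
    using keys_mult[of P Q] by blast
  then show "Poly_Mapping.keys m \<subseteq> A"
    using assms keys_add[of a b] unfolding vars_in_def by blast
qed

lemma vars_in_one: "vars_in 1 A"
  by (simp add: vars_in_def)

lemma vars_in_zero: "vars_in 0 A"
  by (simp add: vars_in_def)

lemma vars_in_indet: "j \<in> A \<Longrightarrow> vars_in (indet j) A"
  by (simp add: vars_in_def indet_def)

lemma vars_in_power: "vars_in P A \<Longrightarrow> vars_in (P ^ k) A"
  by (induction k) (auto intro: vars_in_one vars_in_mult)

lemma vars_in_sum: "(\<And>i. i \<in> I \<Longrightarrow> vars_in (P i) A) \<Longrightarrow> vars_in (sum P I) A"
  by (induction I rule: infinite_finite_induct) (auto intro: vars_in_zero vars_in_add)

lemma vars_in_prod: "(\<And>i. i \<in> I \<Longrightarrow> vars_in (P i) A) \<Longrightarrow> vars_in (prod P I) A"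
  by (induction I rule: infinite_finite_induct) (auto intro: vars_in_one vars_in_mult)

lemma vars_in_alternant:
  assumes "\<And>t. t < length es \<Longrightarrow> vars_in (z t) A"
  shows "vars_in (alternant es z) A"
  unfolding alternant_expand
proof (rule vars_in_sum, rule vars_in_mult)
  fix \<sigma> assume "\<sigma> \<in> {\<sigma>. \<sigma> permutes {..<length es}}"
  then have "\<sigma> s < length es" if "s < length es" for s
    using that permutes_in_image[of \<sigma> "{..<length es}" s] by auto
  then show "vars_in (\<Prod>s<length es. z (\<sigma> s) ^ (es ! s)) A"
    by (intro vars_in_prod vars_in_power assms) auto
  show "vars_in (of_int (sign \<sigma>)) A"
    by (auto simp: sign_def intro: vars_in_one vars_in_uminus)
qed

text \<open>The new monomial enters as a summand, so that additivity of \<open>dpoly\<close>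
  applies, and it is fresh, so that no cancellation disturbs the support.\<close>

lemma poly_mapping_single_induct [case_names zero add_single]:
  assumes "Pr 0"
    and "\<And>P m a. m \<notin> Poly_Mapping.keys P \<Longrightarrow> a \<noteq> 0 \<Longrightarrow> Pr P \<Longrightarrow> Pr (P + Poly_Mapping.single m a)"
  shows "Pr (P :: 'a \<Rightarrow>\<^sub>0 'b::monoid_add)"
proof (induction P rule: update_induct)
  case const
  show ?case by fact
next
  case (update P m a)
  have "Poly_Mapping.update m a P = P + Poly_Mapping.single m a"
    using update(1) by (intro poly_mapping_eqI)
      (auto simp: lookup_update lookup_add lookup_single when_def in_keys_iff)
  then show ?case using assms(2)[OF update(1,2)] update(3) by simp
qed

section \<open>Products and additive maps in a commutative algebra that may lack a unit\<close>

context assoc_comm_algebra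
begin

lemma r_distr_U:
  "\<lbrakk>x \<in> carrier U; y \<in> carrier U; z \<in> carrier U\<rbrakk> \<Longrightarrow>
    x \<otimes>\<^bsub>U\<^esub> (y \<oplus>\<^bsub>U\<^esub> z) = x \<otimes>\<^bsub>U\<^esub> y \<oplus>\<^bsub>U\<^esub> x \<otimes>\<^bsub>U\<^esub> z"
  using mult_comm mult_l_distr M.a_closed by metis

lemma mult_lcomm:
  "\<lbrakk>x \<in> carrier U; y \<in> carrier U; z \<in> carrier U\<rbrakk> \<Longrightarrow>
    x \<otimes>\<^bsub>U\<^esub> (y \<otimes>\<^bsub>U\<^esub> z) = y \<otimes>\<^bsub>U\<^esub> (x \<otimes>\<^bsub>U\<^esub> z)"
  using mult_comm mult_assoc by metis

lemma nonempty_prod_closed: "set xs \<subseteq> carrier U \<Longrightarrow> nonempty_prod U xs \<in> carrier U"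
  by (induction xs rule: induct_list012) (auto intro: mult_closed)

lemma nonempty_prod_Cons: "xs \<noteq> [] \<Longrightarrow> nonempty_prod U (x # xs) = x \<otimes>\<^bsub>U\<^esub> nonempty_prod U xs"
  by (cases xs) auto

lemma nonempty_prod_append:
  "xs \<noteq> [] \<Longrightarrow> ys \<noteq> [] \<Longrightarrow> set xs \<subseteq> carrier U \<Longrightarrow> set ys \<subseteq> carrier U \<Longrightarrow>
    nonempty_prod U (xs @ ys) = nonempty_prod U xs \<otimes>\<^bsub>U\<^esub> nonempty_prod U ys"
proof (induction xs)
  case (Cons x xs)
  then show ?case
    by (cases "xs = []") (auto simp: nonempty_prod_Cons mult_assoc nonempty_prod_closed)
qed simp

text \<open>Two entries are required because the product of the empty remainder would be the dummy
  zero.\<close>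

lemma nonempty_prod_remove1:
  assumes "x \<in> set xs" "set xs \<subseteq> carrier U" "length xs \<ge> 2"
  shows "nonempty_prod U xs = x \<otimes>\<^bsub>U\<^esub> nonempty_prod U (remove1 x xs)"
  using assms
proof (induction xs)
  case (Cons y ys)
  have ne: "ys \<noteq> []" using Cons.prems(3) by auto
  show ?case
  proof (cases "x = y")
    case True
    then show ?thesis using ne by (simp add: nonempty_prod_Cons)
  next
    case False
    then have x: "x \<in> set ys" using Cons.prems(1) by simp
    have car: "x \<in> carrier U" "y \<in> carrier U" "set ys \<subseteq> carrier U" using x Cons.prems(2) by auto
    show ?thesis
    proof (cases "length ys \<ge> 2")
      case True
      have "set (remove1 x ys) \<subseteq> carrier U" using car(3) set_remove1_subset[of x ys] by blast
      moreover have "remove1 x ys \<noteq> []" using True length_remove1[of x ys] x by auto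
      ultimately show ?thesis
        using False ne Cons.IH[OF x car(3) True] car
        by (simp add: nonempty_prod_Cons mult_lcomm nonempty_prod_closed)
    next
      case short: False
      then obtain z where "ys = [z]" using ne by (cases ys) (auto simp: Suc_le_eq)
      then show ?thesis using False x car by (simp add: mult_comm)
    qed
  qed
qed simp

lemma nonempty_prod_mset:
  assumes "mset xs = mset ys" "set xs \<subseteq> carrier U"
  shows "nonempty_prod U xs = nonempty_prod U ys"
  using assms
proof (induction xs arbitrary: ys)
  case (Cons x xs)
  have x: "x \<in> set ys" using Cons.prems(1) by (metis list.set_intros(1) mset_eq_setD)
  have m: "mset xs = mset (remove1 x ys)" using Cons.prems(1) by (metis add_mset_remove_trivial mset.simps(2) mset_remove1)
  have IH: "nonempty_prod U xs = nonempty_prod U (remove1 x ys)"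
    using Cons.IH[OF m] Cons.prems(2) by simp
  have len: "length ys = Suc (length xs)" using Cons.prems(1) by (metis mset_eq_length length_Cons)
  show ?case
  proof (cases "xs = []")
    case True
    then show ?thesis using x len by (cases ys) auto
  next
    case False
    then have "length ys \<ge> 2" using len by (cases xs) auto
    moreover have "set ys \<subseteq> carrier U" using Cons.prems by (metis mset_eq_setD)
    ultimately show ?thesis
      using nonempty_prod_remove1[OF x] IH False by (simp add: nonempty_prod_Cons)
  qed
qed simp

abbreviation additive_map :: "('u \<Rightarrow> 'u) \<Rightarrow> bool" where
  "additive_map f \<equiv> f \<in> hom (add_monoid U) (add_monoid U)"

lemma additive_mapI:
  assumes "\<And>x. x \<in> carrier U \<Longrightarrow> f x \<in> carrier U"
    and "\<And>x y. x \<in> carrier U \<Longrightarrow> y \<in> carrier U \<Longrightarrow> f (x \<oplus>\<^bsub>U\<^esub> y) = f x \<oplus>\<^bsub>U\<^esub> f y"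
  shows "additive_map f"
  using assms by (auto simp: hom_def)

lemma additive_map_closed: "additive_map f \<Longrightarrow> x \<in> carrier U \<Longrightarrow> f x \<in> carrier U"
  by (auto simp: hom_def)

lemma additive_map_add:
  "additive_map f \<Longrightarrow> x \<in> carrier U \<Longrightarrow> y \<in> carrier U \<Longrightarrow> f (x \<oplus>\<^bsub>U\<^esub> y) = f x \<oplus>\<^bsub>U\<^esub> f y"
  by (auto simp: hom_def)

lemma additive_map_zero: "additive_map f \<Longrightarrow> f \<zero>\<^bsub>U\<^esub> = \<zero>\<^bsub>U\<^esub>"
  using hom_one[of f "add_monoid U" "add_monoid U"] M.a_group by simp

lemma additive_map_int_pow:
  fixes k :: int
  shows "additive_map f \<Longrightarrow> x \<in> carrier U \<Longrightarrow> f ([k] \<cdot>\<^bsub>U\<^esub> x) = [k] \<cdot>\<^bsub>U\<^esub> f x"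
  unfolding add_pow_def using hom_int_pow[of f "add_monoid U" "add_monoid U" x k] M.a_group by simp

lemma additive_map_finsum:
  assumes "additive_map f" "finite S" "g \<in> S \<rightarrow> carrier U"
  shows "f (\<Oplus>\<^bsub>U\<^esub>i\<in>S. g i) = (\<Oplus>\<^bsub>U\<^esub>i\<in>S. f (g i))"
  using assms(2,3)
proof (induction S)
  case empty
  then show ?case using additive_map_zero[OF assms(1)] by simp
next
  case (insert i S)
  then show ?case
    using assms(1) by (subst (1 2) M.finsum_insert) (auto simp: additive_map_add additive_map_closed Pi_iff)
qed

lemma additive_map_mult: "x \<in> carrier U \<Longrightarrow> additive_map (\<lambda>y. x \<otimes>\<^bsub>U\<^esub> y)"
  by (rule additive_mapI) (auto simp: mult_closed r_distr_U)

lemma additive_map_mult_right: "x \<in> carrier U \<Longrightarrow> additive_map (\<lambda>y. y \<otimes>\<^bsub>U\<^esub> x)"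
  by (rule additive_mapI) (auto simp: mult_closed mult_l_distr)

text \<open>Entry \<open>i\<close> moves to the front and the product of the others becomes a fixed
  factor. A list of length 1 has no other entries, and without a unit the map is then the identity;
  hence the existential form.\<close>

lemma nonempty_prod_update:
  assumes "i < length xs" "set xs \<subseteq> carrier U"
  shows "\<exists>f. additive_map f \<and> (\<forall>x\<in>carrier U. nonempty_prod U (xs[i := x]) = f x) \<and>
    (\<forall>a\<in>carrier K. \<forall>x\<in>carrier U. f (a \<odot>\<^bsub>U\<^esub> x) = a \<odot>\<^bsub>U\<^esub> f x)"
proof (cases "length xs = 1")
  case True
  then show ?thesis using assms
    by (intro exI[of _ "\<lambda>x. x"]) (auto simp: length_Suc_conv intro: additive_mapI)
next
  case False
  define ys where "ys = take i xs @ drop (Suc i) xs"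
  have ys: "ys \<noteq> []" "set ys \<subseteq> carrier U"
    using assms False set_take_subset[of i xs] set_drop_subset[of "Suc i" xs]
    by (auto simp: ys_def)
  have "nonempty_prod U (xs[i := x]) = x \<otimes>\<^bsub>U\<^esub> nonempty_prod U ys" if "x \<in> carrier U" for x
  proof -
    have "nonempty_prod U (xs[i := x]) = nonempty_prod U (x # ys)"
      using assms ys that set_update_subset_insert[of xs i x]
      by (intro nonempty_prod_mset) (auto simp: upd_conv_take_nth_drop ys_def)
    then show ?thesis using ys by (simp add: nonempty_prod_Cons)
  qed
  then show ?thesis using nonempty_prod_closed[OF ys(2)]
    by (intro exI[of _ "\<lambda>x. x \<otimes>\<^bsub>U\<^esub> nonempty_prod U ys"])
      (auto simp: smult_mult intro: additive_map_mult_right)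
qed

end

section \<open>Integer polynomials acting as multilinear differential operators\<close>

locale differential_algebra = assoc_comm_algebra K U
  for K :: "('k, 'm) ring_scheme" and U :: "('k, 'u, 'z) module_scheme" +
  fixes d :: "'u \<Rightarrow> 'u"
  assumes derivation: "derivation K U d"
begin

lemma d_closed: "x \<in> carrier U \<Longrightarrow> d x \<in> carrier U"
  using derivation by (auto simp: derivation_def)

lemma d_mult: "x \<in> carrier U \<Longrightarrow> y \<in> carrier U \<Longrightarrow> d (x \<otimes>\<^bsub>U\<^esub> y) = d x \<otimes>\<^bsub>U\<^esub> y \<oplus>\<^bsub>U\<^esub> x \<otimes>\<^bsub>U\<^esub> d y"
  using derivation by (auto simp: derivation_def)

lemma additive_map_d: "additive_map d"
  using derivation by (intro additive_mapI) (auto simp: derivation_def)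

lemma d_pow_closed: "x \<in> carrier U \<Longrightarrow> (d ^^ k) x \<in> carrier U"
  by (induction k) (auto simp: d_closed)

lemma additive_map_d_pow: "additive_map (d ^^ k)"
  by (induction k) (auto intro!: additive_mapI
      simp: additive_map_add[OF additive_map_d] additive_map_add d_pow_closed d_closed)

lemma d_pow_smult:
  "a \<in> carrier K \<Longrightarrow> x \<in> carrier U \<Longrightarrow> (d ^^ k) (a \<odot>\<^bsub>U\<^esub> x) = a \<odot>\<^bsub>U\<^esub> (d ^^ k) x"
  using derivation by (induction k) (auto simp: derivation_def d_pow_closed)

text \<open>\<open>dpoly c js P\<close> is the differential operator \<open>P\<close> applied to the arguments \<open>c j\<close> with \<open>j\<close> in \<open>js\<close>.
  Exponents at indices outside \<open>js\<close> are ignored, so a bound on the variables of \<open>P\<close> is needed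
  where it matters.\<close>

definition dmono :: "(nat \<Rightarrow> 'u) \<Rightarrow> nat list \<Rightarrow> (nat \<Rightarrow>\<^sub>0 nat) \<Rightarrow> 'u" where
  "dmono c js m = nonempty_prod U (map (\<lambda>j. (d ^^ Poly_Mapping.lookup m j) (c j)) js)"

definition dpoly :: "(nat \<Rightarrow> 'u) \<Rightarrow> nat list \<Rightarrow> ((nat \<Rightarrow>\<^sub>0 nat) \<Rightarrow>\<^sub>0 int) \<Rightarrow> 'u" where
  "dpoly c js P = (\<Oplus>\<^bsub>U\<^esub>m\<in>Poly_Mapping.keys P. [Poly_Mapping.lookup P m] \<cdot>\<^bsub>U\<^esub> dmono c js m)"

lemma zero_add_pow [simp]: "[(0::int)] \<cdot>\<^bsub>U\<^esub> x = \<zero>\<^bsub>U\<^esub>"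
  by (simp add: add_pow_def)

context
  fixes c :: "nat \<Rightarrow> 'u"
  assumes c: "\<And>j. c j \<in> carrier U"
begin

lemma dmono_closed: "dmono c js m \<in> carrier U"
  unfolding dmono_def by (rule nonempty_prod_closed) (auto simp: c d_pow_closed)

lemma dpoly_superset:
  assumes "finite S" "Poly_Mapping.keys P \<subseteq> S"
  shows "dpoly c js P = (\<Oplus>\<^bsub>U\<^esub>m\<in>S. [Poly_Mapping.lookup P m] \<cdot>\<^bsub>U\<^esub> dmono c js m)"
  unfolding dpoly_def
  by (rule M.add.finprod_mono_neutral_cong_left)
    (use assms in \<open>auto simp: dmono_closed in_keys_iff\<close>)

lemma dpoly_closed: "dpoly c js P \<in> carrier U"
  unfolding dpoly_def by (rule M.finsum_closed) (auto simp: dmono_closed)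

lemma dpoly_zero [simp]: "dpoly c js 0 = \<zero>\<^bsub>U\<^esub>"
  by (simp add: dpoly_def)

lemma dpoly_add: "dpoly c js (P + Q) = dpoly c js P \<oplus>\<^bsub>U\<^esub> dpoly c js Q"
proof -
  let ?S = "Poly_Mapping.keys P \<union> Poly_Mapping.keys Q"
  have "dpoly c js (P + Q) = (\<Oplus>\<^bsub>U\<^esub>m\<in>?S. [Poly_Mapping.lookup P m] \<cdot>\<^bsub>U\<^esub> dmono c js m \<oplus>\<^bsub>U\<^esub>
      [Poly_Mapping.lookup Q m] \<cdot>\<^bsub>U\<^esub> dmono c js m)"
    using keys_add[of P Q]
    by (subst dpoly_superset[of ?S]) (auto simp: lookup_add dmono_closed M.add.int_pow_mult)
  then show ?thesis
    by (subst (1 2) dpoly_superset[of ?S]) (auto simp: dmono_closed M.finsum_addf)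
qed

lemma dpoly_single: "dpoly c js (Poly_Mapping.single m a) = [a] \<cdot>\<^bsub>U\<^esub> dmono c js m"
  by (auto simp: dpoly_def dmono_closed)

lemma dpoly_uminus: "dpoly c js (- P) = \<ominus>\<^bsub>U\<^esub> dpoly c js P"
  using dpoly_add[of js "- P" P] dpoly_closed by (auto intro!: M.minus_equality[symmetric])

lemma dpoly_sum: "finite I \<Longrightarrow> dpoly c js (\<Sum>i\<in>I. P i) = (\<Oplus>\<^bsub>U\<^esub>i\<in>I. dpoly c js (P i))"
  by (induction I rule: finite_induct) (auto simp: dpoly_add dpoly_closed)

lemma dpoly_of_nat_mult: "dpoly c js (of_nat n * P) = [n] \<cdot>\<^bsub>U\<^esub> dpoly c js P"
  by (induction n) (simp_all add: distrib_right dpoly_add dpoly_closed M.add.nat_pow_Suc M.a_comm)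

lemma dpoly_one: "dpoly c [j] 1 = c j"
  unfolding single_one[symmetric] dpoly_single using c by (simp add: dmono_def)

lemma dpoly_mset:
  assumes "mset js = mset ks"
  shows "dpoly c js P = dpoly c ks P"
proof -
  have "dmono c js m = dmono c ks m" for m
    unfolding dmono_def using assms
    by (intro nonempty_prod_mset) (auto simp: c d_pow_closed)
  then show ?thesis by (simp add: dpoly_def)
qed

lemma dmono_append:
  assumes "js \<noteq> []" "ks \<noteq> []"
    and "Poly_Mapping.keys m \<subseteq> set js" "Poly_Mapping.keys k \<subseteq> set ks" "set js \<inter> set ks = {}"
  shows "dmono c (js @ ks) (m + k) = dmono c js m \<otimes>\<^bsub>U\<^esub> dmono c ks k"
proof -
  have "Poly_Mapping.lookup k j = 0" if "j \<in> set js" for j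
    using that assms(4,5) by (auto simp: in_keys_iff)
  moreover have "Poly_Mapping.lookup m j = 0" if "j \<in> set ks" for j
    using that assms(3,5) by (auto simp: in_keys_iff)
  ultimately have "map (\<lambda>j. (d ^^ Poly_Mapping.lookup (m + k) j) (c j)) (js @ ks) =
      map (\<lambda>j. (d ^^ Poly_Mapping.lookup m j) (c j)) js @ map (\<lambda>j. (d ^^ Poly_Mapping.lookup k j) (c j)) ks"
    by (simp add: lookup_add)
  then show ?thesis
    unfolding dmono_def using assms(1,2) by (simp only:) (rule nonempty_prod_append, auto simp: c d_pow_closed)
qed

lemma vars_in_add_single:
  assumes "m \<notin> Poly_Mapping.keys P" "a \<noteq> 0"
  shows "vars_in (P + Poly_Mapping.single m a) A \<longleftrightarrow> vars_in P A \<and> Poly_Mapping.keys m \<subseteq> A"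
proof -
  have "Poly_Mapping.keys (P + Poly_Mapping.single m a) = insert m (Poly_Mapping.keys P)"
    using assms by (auto simp: in_keys_iff lookup_add lookup_single when_def split: if_splits)
  then show ?thesis by (auto simp: vars_in_def)
qed

text \<open>Both sides are additive in \<open>P\<close> and in \<open>Q\<close>, which reduces the
  claim to monomials; there the disjointness of the two blocks lets the exponents separate.\<close>

lemma dpoly_mult:
  assumes ne: "js \<noteq> []" "ks \<noteq> []" "set js \<inter> set ks = {}"
    and "vars_in P (set js)" "vars_in Q (set ks)"
  shows "dpoly c (js @ ks) (P * Q) = dpoly c js P \<otimes>\<^bsub>U\<^esub> dpoly c ks Q"
  using assms(4)
proof (induction P rule: poly_mapping_single_induct)
  case zero
  then show ?case
    using additive_map_zero[OF additive_map_mult_right[OF dpoly_closed]] by simp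
next
  case (add_single P m a)
  then have P: "vars_in P (set js)" and m: "Poly_Mapping.keys m \<subseteq> set js"
    by (simp_all add: vars_in_add_single)
  have "dpoly c (js @ ks) (Poly_Mapping.single m a * Q) =
      dpoly c js (Poly_Mapping.single m a) \<otimes>\<^bsub>U\<^esub> dpoly c ks Q"
    using assms(5)
  proof (induction Q rule: poly_mapping_single_induct)
    case zero
    then show ?case
      using additive_map_zero[OF additive_map_mult[OF dpoly_closed]] by simp
  next
    case (add_single Q k b)
    then have Q: "vars_in Q (set ks)" and k: "Poly_Mapping.keys k \<subseteq> set ks"
      by (simp_all add: vars_in_add_single)
    have "dpoly c (js @ ks) (Poly_Mapping.single m a * Poly_Mapping.single k b) =
        add_pow U (a * b) (dmono c js m \<otimes>\<^bsub>U\<^esub> dmono c ks k)"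
      by (simp add: mult_single dpoly_single dmono_append[OF ne(1,2) m k ne(3)])
    also have "\<dots> = [b] \<cdot>\<^bsub>U\<^esub> ([a] \<cdot>\<^bsub>U\<^esub> (dmono c js m \<otimes>\<^bsub>U\<^esub> dmono c ks k))"
      by (rule M.add.int_pow_pow[symmetric]) (intro mult_closed dmono_closed)
    also have "\<dots> = ([a] \<cdot>\<^bsub>U\<^esub> dmono c js m) \<otimes>\<^bsub>U\<^esub> ([b] \<cdot>\<^bsub>U\<^esub> dmono c ks k)"
      by (simp add: additive_map_int_pow[OF additive_map_mult] additive_map_int_pow[OF additive_map_mult_right] dmono_closed)
    finally show ?case using add_single.IH[OF Q]
      by (simp add: distrib_left dpoly_add dpoly_single r_distr_U dpoly_closed dmono_closed)
  qed
  then show ?case using add_single.IH[OF P]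
    by (simp add: distrib_right dpoly_add mult_l_distr dpoly_closed)
qed

text \<open>The Leibniz rule, by splitting off the head: since the indices are distinct, raising the
  exponent at the head leaves the tail unchanged and conversely.\<close>

lemma d_dmono:
  assumes "distinct js" "js \<noteq> []"
  shows "d (dmono c js m) = (\<Oplus>\<^bsub>U\<^esub>i\<in>set js. dmono c js (m + Poly_Mapping.single i 1))"
  using assms
proof (induction js)
  case (Cons j js)
  let ?e = "\<lambda>i. Poly_Mapping.single i (1::nat)"
  let ?x = "\<lambda>k. (d ^^ k) (c j)"
  show ?case
  proof (cases "js = []")
    case True
    then show ?thesis by (simp add: dmono_def lookup_add c d_closed d_pow_closed)
  next
    case False
    have split: "dmono c (j # js) k = ?x (Poly_Mapping.lookup k j) \<otimes>\<^bsub>U\<^esub> dmono c js k" for k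
      using False by (simp add: dmono_def nonempty_prod_Cons)
    have same: "dmono c js (m + ?e j) = dmono c js m"
      unfolding dmono_def using Cons.prems(1)
      by (intro arg_cong[of _ _ "nonempty_prod U"] map_cong refl) (auto simp: lookup_add lookup_single when_def)
    have other: "Poly_Mapping.lookup (m + ?e i) j = Poly_Mapping.lookup m j" if "i \<in> set js" for i
      using that Cons.prems(1) by (auto simp: lookup_add lookup_single when_def)
    let ?k = "Poly_Mapping.lookup m j"
    have "d (dmono c (j # js) m) = d (?x ?k) \<otimes>\<^bsub>U\<^esub> dmono c js m \<oplus>\<^bsub>U\<^esub> ?x ?k \<otimes>\<^bsub>U\<^esub> d (dmono c js m)"
      unfolding split by (simp add: d_mult d_pow_closed c dmono_closed)
    also have "d (?x ?k) \<otimes>\<^bsub>U\<^esub> dmono c js m = dmono c (j # js) (m + ?e j)"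
      unfolding split same by (simp add: lookup_add)
    also have "?x ?k \<otimes>\<^bsub>U\<^esub> d (dmono c js m) = (\<Oplus>\<^bsub>U\<^esub>i\<in>set js. ?x ?k \<otimes>\<^bsub>U\<^esub> dmono c js (m + ?e i))"
      using Cons False
      by (simp add: additive_map_finsum[OF additive_map_mult] d_pow_closed c dmono_closed)
    also have "\<dots> = (\<Oplus>\<^bsub>U\<^esub>i\<in>set js. dmono c (j # js) (m + ?e i))"
      by (rule M.finsum_cong') (auto simp: dmono_closed split other[simplified] mult_closed d_pow_closed c)
    finally show ?thesis using Cons.prems(1) by (simp add: dmono_closed)
  qed
qed simp

text \<open>This is the Leibniz rule in terms of symbols: multiplication by an indeterminate raises
  one exponent.\<close>

lemma d_dpoly:
  assumes js: "distinct js" "js \<noteq> []"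
  shows "d (dpoly c js P) = dpoly c js ((\<Sum>j\<in>set js. indet j) * P)"
proof (induction P rule: poly_mapping_single_induct)
  case zero
  show ?case by (simp add: additive_map_zero[OF additive_map_d])
next
  case (add_single P m a)
  have "dpoly c js ((\<Sum>j\<in>set js. indet j) * Poly_Mapping.single m a) =
      (\<Oplus>\<^bsub>U\<^esub>j\<in>set js. [a] \<cdot>\<^bsub>U\<^esub> dmono c js (m + Poly_Mapping.single j 1))"
    by (simp add: indet_def sum_distrib_right dpoly_sum mult_single dpoly_single add.commute)
  also have "\<dots> = [a] \<cdot>\<^bsub>U\<^esub> d (dmono c js m)"
    unfolding d_dmono[OF js]
    by (rule additive_map_finsum[symmetric, of "\<lambda>x. [a] \<cdot>\<^bsub>U\<^esub> x"])
      (auto intro!: additive_mapI simp: dmono_closed M.add.int_pow_distrib)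
  also have "\<dots> = d (dpoly c js (Poly_Mapping.single m a))"
    by (simp add: dpoly_single additive_map_int_pow[OF additive_map_d] dmono_closed)
  finally show ?case using add_single.IH
    by (simp add: distrib_left dpoly_add additive_map_add[OF additive_map_d] dpoly_closed)
qed

lemma d_pow_dpoly:
  assumes "distinct js" "js \<noteq> []"
  shows "(d ^^ k) (dpoly c js P) = dpoly c js ((\<Sum>j\<in>set js. indet j) ^ k * P)"
  by (induction k) (simp_all add: d_dpoly[OF assms] mult.assoc)

lemma nonempty_prod_dpoly:
  assumes "\<And>t. t \<le> n \<Longrightarrow> B t \<noteq> []" "\<And>t. t \<le> n \<Longrightarrow> vars_in (P t) (set (B t))"
    and "\<And>s t. s \<le> n \<Longrightarrow> t \<le> n \<Longrightarrow> s \<noteq> t \<Longrightarrow> set (B s) \<inter> set (B t) = {}"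
  shows "nonempty_prod U (map (\<lambda>t. dpoly c (B t) (P t)) [0..<Suc n]) =
    dpoly c (concat (map B [0..<Suc n])) (\<Prod>t<Suc n. P t)"
  using assms
proof (induction n)
  case 0
  then show ?case by simp
next
  case (Suc n)
  let ?L = "concat (map B [0..<Suc n])"
  have IH: "nonempty_prod U (map (\<lambda>t. dpoly c (B t) (P t)) [0..<Suc n]) = dpoly c ?L (\<Prod>t<Suc n. P t)"
    by (rule Suc.IH) (use Suc.prems in auto)
  have "nonempty_prod U (map (\<lambda>t. dpoly c (B t) (P t)) [0..<Suc (Suc n)]) =
      dpoly c ?L (\<Prod>t<Suc n. P t) \<otimes>\<^bsub>U\<^esub> dpoly c (B (Suc n)) (P (Suc n))"
    unfolding IH[symmetric]
    by (subst upt_Suc_append, simp, subst map_append, subst nonempty_prod_append)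
      (auto simp: dpoly_closed)
  also have "\<dots> = dpoly c (?L @ B (Suc n)) ((\<Prod>t<Suc n. P t) * P (Suc n))"
  proof (rule dpoly_mult[symmetric])
    show "?L \<noteq> []" "B (Suc n) \<noteq> []" using Suc.prems(1) by auto
    show "set ?L \<inter> set (B (Suc n)) = {}"
      using Suc.prems(3)[of _ "Suc n"]
      by (auto simp del: upt_Suc simp: less_Suc_eq_le) (metis IntI Suc_n_not_le_n emptyE le_SucI le_refl)+
    show "vars_in (\<Prod>t<Suc n. P t) (set ?L)"
    proof (rule vars_in_prod)
      fix t assume "t \<in> {..<Suc n}"
      then show "vars_in (P t) (set ?L)"
        by (intro vars_in_mono[OF Suc.prems(2)[of t]]) (auto simp del: upt_Suc)
    qed
    show "vars_in (P (Suc n)) (set (B (Suc n)))" using Suc.prems(2) by simp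
  qed
  finally show ?case by simp
qed

text \<open>Arguments that are themselves differential polynomials
  in disjoint blocks of variables combine by multiplication, and \<open>d\<close> acts on a block
  as multiplication by the sum of its indeterminates.\<close>

lemma gen_wronskian_dpoly:
  assumes n: "length es = n" "length w = n" "n > 0"
    and w: "\<And>t. t < n \<Longrightarrow> w ! t = dpoly c (B t) (Q t)"
    and B: "\<And>t. t < n \<Longrightarrow> B t \<noteq> []" "\<And>t. t < n \<Longrightarrow> distinct (B t)"
    and Q: "\<And>t. t < n \<Longrightarrow> vars_in (Q t) (set (B t))"
    and disj: "\<And>s t. s < n \<Longrightarrow> t < n \<Longrightarrow> s \<noteq> t \<Longrightarrow> set (B s) \<inter> set (B t) = {}"
    and L: "distinct L" "set L = (\<Union>t<n. set (B t))"
  shows "gen_wronskian U d es w =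
    dpoly c L (alternant es (\<lambda>t. \<Sum>j\<in>set (B t). indet j) * (\<Prod>t<n. Q t))"
proof -
  define S where "S t = (\<Sum>j\<in>set (B t). indet j)" for t
  have "distinct (concat (map B [0..<n]))"
  proof (rule distinct_concat)
    show "distinct (map B [0..<n])"
      using disj B(1) by (fastforce simp: distinct_map inj_on_def)
    show "\<And>ys. ys \<in> set (map B [0..<n]) \<Longrightarrow> distinct ys" using B(2) by auto
    fix ys zs assume "ys \<in> set (map B [0..<n])" "zs \<in> set (map B [0..<n])" "ys \<noteq> zs"
    moreover then obtain s t where "s < n" "t < n" "ys = B s" "zs = B t" by auto
    ultimately show "set ys \<inter> set zs = {}" using disj[of s t] by auto
  qed
  moreover have "set (concat (map B [0..<n])) = set L" using L(2) by auto
  \<comment> \<open>Both lists are distinct with the same elements, so \<open>L\<close> may replace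
    the concatenated blocks.\<close>
  ultimately have ms: "mset (concat (map B [0..<n])) = mset L"
    using L(1) set_eq_iff_mset_eq_distinct by blast
  have wc: "w ! t \<in> carrier U" if "t < n" for t using that w dpoly_closed by simp
  have summand: "nonempty_prod U (map (\<lambda>s. (d ^^ (es ! s)) (w ! \<sigma> s)) [0..<n]) =
      dpoly c L ((\<Prod>s<n. S (\<sigma> s) ^ (es ! s)) * (\<Prod>t<n. Q t))"
    if \<sigma>: "\<sigma> permutes {..<n}" for \<sigma>
  proof -
    \<comment> \<open>The determinant lists its factors by rows, but the blocks of variables belong
      to columns; the inverse permutation reorders the product by columns.\<close>
    define \<pi> where "\<pi> = inv_into UNIV \<sigma>"
    define g where "g t = (d ^^ (es ! \<pi> t)) (w ! t)" for t
    have inv: "\<pi> (\<sigma> s) = s" for s unfolding \<pi>_def using \<sigma> by (rule permutes_inverses)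
    have "mset (map (\<lambda>s. g (\<sigma> s)) [0..<n]) = image_mset g (image_mset \<sigma> (mset_set {..<n}))"
      by (simp add: atLeast0LessThan multiset.map_comp comp_def)
    also have "image_mset \<sigma> (mset_set {..<n}) = mset_set {..<n}"
      using \<sigma> by (simp add: image_mset_mset_set permutes_inj_on permutes_image)
    finally have "mset (map (\<lambda>s. g (\<sigma> s)) [0..<n]) = mset (map g [0..<n])"
      by (simp add: atLeast0LessThan)
    moreover have "\<sigma> s < n" if "s < n" for s
      using that permutes_in_image[OF \<sigma>, of s] by simp
    ultimately have "nonempty_prod U (map (\<lambda>s. (d ^^ (es ! s)) (w ! \<sigma> s)) [0..<n]) =
        nonempty_prod U (map g [0..<n])"
      by (intro nonempty_prod_mset) (auto simp: g_def inv d_pow_closed wc)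
    also have "map g [0..<n] = map (\<lambda>t. dpoly c (B t) (S t ^ (es ! \<pi> t) * Q t)) [0..<n]"
      using B by (auto simp: g_def w d_pow_dpoly S_def)
    also have "nonempty_prod U \<dots> =
        dpoly c (concat (map B [0..<n])) (\<Prod>t<n. S t ^ (es ! \<pi> t) * Q t)"
    proof -
      obtain n' where n': "n = Suc n'" using n(3) by (cases n) auto
      show ?thesis unfolding n'
        by (rule nonempty_prod_dpoly)
          (use B Q disj n' in \<open>auto simp: less_Suc_eq_le S_def
             intro!: vars_in_mult vars_in_power vars_in_sum vars_in_indet\<close>)
    qed
    also have "\<dots> = dpoly c L (\<Prod>t<n. S t ^ (es ! \<pi> t) * Q t)"
      by (rule dpoly_mset[OF ms])
    also have "(\<Prod>t<n. S t ^ (es ! \<pi> t) * Q t) =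
        (\<Prod>t<n. S t ^ (es ! \<pi> t)) * (\<Prod>t<n. Q t)"
      by (rule prod.distrib)
    also have "(\<Prod>t<n. S t ^ (es ! \<pi> t)) = (\<Prod>s<n. S (\<sigma> s) ^ (es ! s))"
      using prod.permute[OF \<sigma>, of "\<lambda>t. S t ^ (es ! \<pi> t)"] by (simp add: inv)
    finally show ?thesis .
  qed
  let ?T = "\<lambda>\<sigma>. (\<Prod>s<n. S (\<sigma> s) ^ (es ! s)) * (\<Prod>t<n. Q t)"
  have "gen_wronskian U d es w =
      (\<Oplus>\<^bsub>U\<^esub>\<sigma>\<in>{\<sigma>. \<sigma> permutes {..<n}}. dpoly c L (of_int (sign \<sigma>) * ?T \<sigma>))"
    unfolding gen_wronskian_def determinant_def n(1)
    by (rule M.finsum_cong') (auto simp: summand dpoly_closed sign_def dpoly_uminus)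
  also have "\<dots> = dpoly c L (\<Sum>\<sigma> | \<sigma> permutes {..<n}. of_int (sign \<sigma>) * ?T \<sigma>)"
    by (rule dpoly_sum[symmetric]) (simp add: finite_permutations)
  also have "(\<Sum>\<sigma> | \<sigma> permutes {..<n}. of_int (sign \<sigma>) * ?T \<sigma>) = alternant es S * (\<Prod>t<n. Q t)"
    by (simp add: alternant_expand n(1) sum_distrib_right mult.assoc)
  finally show ?thesis by (simp add: S_def[abs_def])
qed

end

end

section \<open>The Jacobi identity from a divisibility\<close>

context differential_algebra
begin

text \<open>Padding with zero makes every value lie in the carrier, as the results on
  \<open>dpoly\<close> assume of their assignment.\<close>

definition env :: "'u list \<Rightarrow> nat \<Rightarrow> 'u" where
  "env us j = (if j < length us then us ! j else \<zero>\<^bsub>U\<^esub>)"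

lemma env_closed: "set us \<subseteq> carrier U \<Longrightarrow> env us j \<in> carrier U"
  by (auto simp: env_def)

text \<open>Every argument is a block of one variable with the constant polynomial 1.\<close>

lemma gen_wronskian_eq_dpoly:
  assumes "us \<in> tuples U (length es)" "es \<noteq> []"
  shows "gen_wronskian U d es us = dpoly (env us) [0..<length es] (alternant es indet)"
proof -
  have us: "length us = length es" "set us \<subseteq> carrier U" using assms(1) by (auto simp: tuples_def)
  have "gen_wronskian U d es us = dpoly (env us) [0..<length es]
      (alternant es (\<lambda>t. \<Sum>j\<in>set [t]. indet j) * (\<Prod>t<length es. 1))"
    by (rule gen_wronskian_dpoly)
      (use us assms(2) env_closed[OF us(2)] in \<open>auto simp: dpoly_one vars_in_one env_def\<close>)
  then show ?thesis by simp
qed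

lemma gen_wronskian_closed:
  assumes "us \<in> tuples U (length es)" "es \<noteq> []"
  shows "gen_wronskian U d es us \<in> carrier U"
  unfolding gen_wronskian_eq_dpoly[OF assms]
  using assms(1) by (intro dpoly_closed env_closed) (auto simp: tuples_def)

lemma dmono_update:
  assumes us: "us \<in> tuples U n" and "i < n"
  shows "\<exists>f. additive_map f \<and>
    (\<forall>x\<in>carrier U. dmono (env (us[i := x])) [0..<n] m = f x) \<and>
    (\<forall>a\<in>carrier K. \<forall>x\<in>carrier U. f (a \<odot>\<^bsub>U\<^esub> x) = a \<odot>\<^bsub>U\<^esub> f x)"
proof -
  let ?e = "Poly_Mapping.lookup m"
  define xs where "xs = map (\<lambda>j. (d ^^ ?e j) (us ! j)) [0..<n]"
  have len: "length us = n" "set us \<subseteq> carrier U" using us by (auto simp: tuples_def)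
  then have "i < length xs" "set xs \<subseteq> carrier U"
    using \<open>i < n\<close> by (auto simp: xs_def intro!: d_pow_closed)
  then obtain f where f: "additive_map f" "\<And>x. x \<in> carrier U \<Longrightarrow> nonempty_prod U (xs[i := x]) = f x"
    "\<And>a x. a \<in> carrier K \<Longrightarrow> x \<in> carrier U \<Longrightarrow> f (a \<odot>\<^bsub>U\<^esub> x) = a \<odot>\<^bsub>U\<^esub> f x"
    using nonempty_prod_update[of i xs] by blast
  have "dmono (env (us[i := x])) [0..<n] m = f ((d ^^ ?e i) x)" if "x \<in> carrier U" for x
  proof -
    have "map (\<lambda>j. (d ^^ ?e j) (env (us[i := x]) j)) [0..<n] = xs[i := (d ^^ ?e i) x]"
      using len \<open>i < n\<close> by (intro nth_equalityI) (auto simp: xs_def env_def nth_list_update)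
    then show ?thesis unfolding dmono_def using that by (simp add: f(2) d_pow_closed)
  qed
  then show ?thesis using f
    by (intro exI[of _ "\<lambda>x. f ((d ^^ ?e i) x)"])
      (auto intro!: additive_mapI simp: additive_map_closed additive_map_add
        additive_map_add[OF additive_map_d_pow] d_pow_closed d_pow_smult)
qed

lemma add_pow_smult:
  fixes k :: int
  assumes "a \<in> carrier K" "x \<in> carrier U"
  shows "[k] \<cdot>\<^bsub>U\<^esub> (a \<odot>\<^bsub>U\<^esub> x) = a \<odot>\<^bsub>U\<^esub> ([k] \<cdot>\<^bsub>U\<^esub> x)"
  by (rule additive_map_int_pow[of "\<lambda>x. a \<odot>\<^bsub>U\<^esub> x", symmetric])
    (use assms in \<open>auto intro!: additive_mapI simp: smult_r_distr\<close>)

text \<open>Each monomial is linear in argument \<open>i\<close> by \<open>dmono_update\<close>, and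
  the Wronskian is a fixed integer combination of monomials.\<close>

lemma n_linear_gen_wronskian:
  assumes "es \<noteq> []"
  shows "n_linear K U (length es) (gen_wronskian U d es)"
proof -
  let ?n = "length es" and ?P = "alternant es indet"
  have upd: "us[i := x] \<in> tuples U ?n" if "us \<in> tuples U ?n" "x \<in> carrier U" for us i x
    using that set_update_subset_insert[of us i x] by (auto simp: tuples_def)
  have car: "env us j \<in> carrier U" if "us \<in> tuples U ?n" for us j
    using that by (intro env_closed) (auto simp: tuples_def)
  have "gen_wronskian U d es (us[i := x \<oplus>\<^bsub>U\<^esub> y]) =
      gen_wronskian U d es (us[i := x]) \<oplus>\<^bsub>U\<^esub> gen_wronskian U d es (us[i := y])"
    if us: "us \<in> tuples U ?n" "i < ?n" "x \<in> carrier U" "y \<in> carrier U" for us i x y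
  proof -
    have "dmono (env (us[i := x \<oplus>\<^bsub>U\<^esub> y])) [0..<?n] m =
        dmono (env (us[i := x])) [0..<?n] m \<oplus>\<^bsub>U\<^esub> dmono (env (us[i := y])) [0..<?n] m" for m
      using dmono_update[OF us(1,2), of m] us(3,4) by (auto simp: additive_map_add)
    then show ?thesis
      using us upd assms car dmono_closed
      by (simp add: gen_wronskian_eq_dpoly dpoly_def M.add.int_pow_distrib M.finsum_addf Pi_def)
  qed
  moreover have "gen_wronskian U d es (us[i := a \<odot>\<^bsub>U\<^esub> x]) = a \<odot>\<^bsub>U\<^esub> gen_wronskian U d es (us[i := x])"
    if us: "us \<in> tuples U ?n" "i < ?n" "a \<in> carrier K" "x \<in> carrier U" for us i a x
  proof -
    have "dmono (env (us[i := a \<odot>\<^bsub>U\<^esub> x])) [0..<?n] m =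
        a \<odot>\<^bsub>U\<^esub> dmono (env (us[i := x])) [0..<?n] m" for m
      using dmono_update[OF us(1,2), of m] us(3,4) by auto
    then show ?thesis
      using us upd assms car dmono_closed
      by (simp add: gen_wronskian_eq_dpoly dpoly_def add_pow_smult finsum_smult_ldistr Pi_def)
  qed
  ultimately show ?thesis using gen_wronskian_closed assms by (auto simp: n_linear_def)
qed

text \<open>Composition with the transposition of \<open>i\<close> and \<open>j\<close> pairs even
  with odd permutations, and paired terms cancel. A mere change of sign under transposition would
  not give the vanishing in characteristic 2.\<close>

lemma alternating_gen_wronskian: "alternating U (length es) (gen_wronskian U d es)"
  unfolding alternating_def
proof (intro ballI allI impI, elim conjE)
  let ?n = "length es"
  fix us i j assume us: "us \<in> tuples U ?n" and ij: "i < ?n" "j < ?n" "i \<noteq> j" "us ! i = us ! j"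
  define T where "T \<sigma> = nonempty_prod U (map (\<lambda>s. (d ^^ (es ! s)) (us ! \<sigma> s)) [0..<?n])" for \<sigma>
  define E where "E = {\<sigma>. \<sigma> permutes {..<?n} \<and> evenperm \<sigma>}"
  define \<tau> where "\<tau> = Transposition.transpose i j"
  have \<tau>: "\<tau> permutes {..<?n}" "\<not> evenperm \<tau>"
    using ij by (auto simp: \<tau>_def permutes_swap_id evenperm_swap)
  have \<tau>\<tau>: "\<tau> \<circ> (\<tau> \<circ> \<sigma>) = \<sigma>" for \<sigma> by (auto simp: \<tau>_def comp_def)
  have fin: "finite E" unfolding E_def by (simp add: finite_permutations)
  have perm: "permutation \<sigma>" if "\<sigma> permutes {..<?n}" for \<sigma>
    using that permutation_permutes by blast
  have lt: "\<sigma> s < ?n" if "\<sigma> permutes {..<?n}" "s < ?n" for \<sigma> s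
    using permutes_in_image[OF that(1), of s] that(2) by simp
  have Tc: "T \<sigma> \<in> carrier U" if "\<sigma> permutes {..<?n}" for \<sigma>
    unfolding T_def using us lt[OF that]
    by (intro nonempty_prod_closed) (auto simp: tuples_def intro!: d_pow_closed)
  have T\<tau>: "T (\<tau> \<circ> \<sigma>) = T \<sigma>" for \<sigma>
  proof -
    have "us ! \<tau> k = us ! k" for k using ij(4) by (auto simp: \<tau>_def Transposition.transpose_def)
    then show ?thesis by (simp add: T_def)
  qed
  have odd: "{\<sigma>. \<sigma> permutes {..<?n} \<and> \<not> evenperm \<sigma>} = (\<lambda>\<sigma>. \<tau> \<circ> \<sigma>) ` E"
  proof safe
    fix \<sigma> assume \<sigma>: "\<sigma> permutes {..<?n}" "\<not> evenperm \<sigma>"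
    then have "\<tau> \<circ> \<sigma> \<in> E"
      using \<tau> permutes_compose[OF \<sigma>(1) \<tau>(1)] by (simp add: E_def evenperm_comp perm)
    then show "\<sigma> \<in> (\<lambda>\<sigma>. \<tau> \<circ> \<sigma>) ` E" using \<tau>\<tau>[of \<sigma>] by (metis image_eqI)
  next
    fix \<sigma> assume "\<sigma> \<in> E"
    then have \<sigma>: "\<sigma> permutes {..<?n}" "evenperm \<sigma>" by (auto simp: E_def)
    show "\<tau> \<circ> \<sigma> permutes {..<?n}" by (rule permutes_compose[OF \<sigma>(1) \<tau>(1)])
    assume "evenperm (\<tau> \<circ> \<sigma>)"
    then show False using \<sigma> \<tau> by (simp add: evenperm_comp perm)
  qed
  have inj: "inj_on (\<lambda>\<sigma>. \<tau> \<circ> \<sigma>) E" by (metis inj_onI \<tau>\<tau>)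
  let ?O = "{\<sigma>. \<sigma> permutes {..<?n} \<and> \<not> evenperm \<sigma>}"
  let ?f = "\<lambda>\<sigma>. if evenperm \<sigma> then T \<sigma> else \<ominus>\<^bsub>U\<^esub> T \<sigma>"
  have "gen_wronskian U d es us = (\<Oplus>\<^bsub>U\<^esub>\<sigma>\<in>{\<sigma>. \<sigma> permutes {..<?n}}. ?f \<sigma>)"
    unfolding gen_wronskian_def determinant_def T_def ..
  also have "{\<sigma>. \<sigma> permutes {..<?n}} = E \<union> ?O" by (auto simp: E_def)
  also have "(\<Oplus>\<^bsub>U\<^esub>\<sigma>\<in>E \<union> ?O. ?f \<sigma>) = (\<Oplus>\<^bsub>U\<^esub>\<sigma>\<in>E. ?f \<sigma>) \<oplus>\<^bsub>U\<^esub> (\<Oplus>\<^bsub>U\<^esub>\<sigma>\<in>?O. ?f \<sigma>)"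
    by (rule M.finsum_Un_disjoint) (use fin in \<open>auto simp: E_def finite_permutations Tc\<close>)
  also have "(\<Oplus>\<^bsub>U\<^esub>\<sigma>\<in>E. ?f \<sigma>) = (\<Oplus>\<^bsub>U\<^esub>\<sigma>\<in>E. T \<sigma>)"
    by (rule M.finsum_cong') (auto simp: E_def Tc)
  also have "(\<Oplus>\<^bsub>U\<^esub>\<sigma>\<in>?O. ?f \<sigma>) = (\<Oplus>\<^bsub>U\<^esub>\<sigma>\<in>?O. \<ominus>\<^bsub>U\<^esub> T \<sigma>)"
    by (rule M.finsum_cong') (auto simp: Tc)
  also have "\<dots> = (\<Oplus>\<^bsub>U\<^esub>\<sigma>\<in>E. \<ominus>\<^bsub>U\<^esub> T (\<tau> \<circ> \<sigma>))"
    unfolding odd by (rule M.finsum_reindex) (use inj in \<open>auto simp: T\<tau> E_def Tc\<close>)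
  also have "\<dots> = (\<Oplus>\<^bsub>U\<^esub>\<sigma>\<in>E. \<ominus>\<^bsub>U\<^esub> T \<sigma>)" by (simp add: T\<tau>)
  also have "(\<Oplus>\<^bsub>U\<^esub>\<sigma>\<in>E. T \<sigma>) \<oplus>\<^bsub>U\<^esub> \<dots> = (\<Oplus>\<^bsub>U\<^esub>\<sigma>\<in>E. T \<sigma> \<oplus>\<^bsub>U\<^esub> \<ominus>\<^bsub>U\<^esub> T \<sigma>)"
    by (rule M.finsum_addf[symmetric]) (auto simp: E_def Tc)
  also have "\<dots> = (\<Oplus>\<^bsub>U\<^esub>\<sigma>\<in>E. \<zero>\<^bsub>U\<^esub>)"
    by (rule M.finsum_cong') (auto simp: E_def Tc M.r_neg)
  finally show "gen_wronskian U d es us = \<zero>\<^bsub>U\<^esub>" by simp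
qed

text \<open>Both sides become polynomials in the indeterminates of \<open>as @ bs\<close>. An inner
  Wronskian is one argument whose block consists of all its variables, so the outer alternant is
  evaluated at their sum. The two polynomials differ by a multiple of \<open>p\<close>, which
  annihilates \<open>U\<close>.\<close>

lemma gen_wronskian_jacobi:
  assumes p: "\<And>x. x \<in> carrier U \<Longrightarrow> [p] \<cdot>\<^bsub>U\<^esub> x = \<zero>\<^bsub>U\<^esub>"
    and es: "length es = Suc N"
    and dvd: "\<And>x y :: nat \<Rightarrow> (nat \<Rightarrow>\<^sub>0 nat) \<Rightarrow>\<^sub>0 int. of_nat p dvd alternant_defect es x y"
    and as: "as \<in> tuples U N" and bs: "bs \<in> tuples U (Suc N)"
  shows "gen_wronskian U d es (as @ [gen_wronskian U d es bs]) =
    (\<Oplus>\<^bsub>U\<^esub>i\<in>{..<Suc N}. gen_wronskian U d es (bs[i := gen_wronskian U d es (as @ [bs ! i])]))"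
proof -
  let ?W = "gen_wronskian U d es" and ?n = "Suc N"
  define c where "c = env (as @ bs)"
  have ab: "length as = N" "set as \<subseteq> carrier U" "length bs = ?n" "set bs \<subseteq> carrier U"
    using as bs by (auto simp: tuples_def)
  have c: "c j \<in> carrier U" for j unfolding c_def using ab by (intro env_closed) auto
  have ca: "dpoly c [j] 1 = as ! j" if "j < N" for j
    using that ab by (simp add: dpoly_one[OF c]) (simp add: c_def env_def nth_append)
  have cb: "dpoly c [N + i] 1 = bs ! i" if "i < ?n" for i
    using that ab by (simp add: dpoly_one[OF c]) (simp add: c_def env_def nth_append)
  define L where "L = [0..<N + ?n]"
  \<comment> \<open>Indices below \<open>N\<close> belong to \<open>as\<close>, and
    \<open>N + i\<close> belongs to entry \<open>i\<close> of \<open>bs\<close>.\<close>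
  define x y where "x = indet" and "y i = indet (N + i)" for i
  have Wb: "?W bs = dpoly c [N..<N + ?n] (alternant es y)"
  proof -
    have "?W bs = dpoly c [N..<N + ?n]
        (alternant es (\<lambda>t. \<Sum>j\<in>set [N + t]. indet j) * (\<Prod>t<?n. 1))"
    proof (rule gen_wronskian_dpoly[OF c])
      show "set [N..<N + ?n] = (\<Union>t<?n. set [N + t])"
      proof safe
        fix j assume "j \<in> set [N..<N + ?n]"
        then show "j \<in> (\<Union>t<?n. set [N + t])" by (intro UN_I[of "j - N"]) auto
      qed auto
    qed (use es ab cb in \<open>auto simp: vars_in_one\<close>)
    then show ?thesis by (simp add: y_def[abs_def])
  qed
  have Wa: "?W (as @ [bs ! i]) = dpoly c ([0..<N] @ [N + i]) (alternant es (x(N := y i)))"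
    if i: "i < ?n" for i
  proof -
    let ?B = "\<lambda>t. if t < N then [t] else [N + i]"
    have "?W (as @ [bs ! i]) = dpoly c ([0..<N] @ [N + i])
        (alternant es (\<lambda>t. \<Sum>j\<in>set (?B t). indet j) * (\<Prod>t<?n. 1))"
      by (rule gen_wronskian_dpoly[OF c])
        (use es ab ca cb i in \<open>auto simp: vars_in_one nth_append less_Suc_eq split: if_splits\<close>)
    also have "alternant es (\<lambda>t. \<Sum>j\<in>set (?B t). indet j) = alternant es (x(N := y i))"
      by (rule alternant_cong) (use es in \<open>auto simp: x_def y_def less_Suc_eq\<close>)
    finally show ?thesis by simp
  qed
  have lhs: "?W (as @ [?W bs]) =
      dpoly c L (alternant es (x(N := \<Sum>i<?n. y i)) * alternant es y)"
  proof -
    \<comment> \<open>The last argument is the inner Wronskian; its block is all of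
      \<open>bs\<close>, with variable sum \<open>\<Sum>i<?n. y i\<close>.\<close>
    let ?B = "\<lambda>t. if t < N then [t] else [N..<N + ?n]"
    let ?Q = "\<lambda>t. if t < N then 1 else alternant es y"
    have "?W (as @ [?W bs]) = dpoly c L
        (alternant es (\<lambda>t. \<Sum>j\<in>set (?B t). indet j) * (\<Prod>t<?n. ?Q t))"
    proof (rule gen_wronskian_dpoly[OF c])
      show "set L = (\<Union>t<?n. set (?B t))"
      proof safe
        fix j assume "j \<in> set L"
        then show "j \<in> (\<Union>t<?n. set (?B t))"
          by (cases "j < N") (auto simp: L_def intro: UN_I[of j] UN_I[of N])
      qed (auto simp: L_def split: if_splits)
      show "vars_in (?Q t) (set (?B t))" if "t < ?n" for t
        using that es by (auto simp: vars_in_one y_def intro!: vars_in_alternant vars_in_indet)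
    qed (use es ab ca Wb in \<open>auto simp: L_def nth_append less_Suc_eq split: if_splits\<close>)
    also have "alternant es (\<lambda>t. \<Sum>j\<in>set (?B t). indet j) = alternant es (x(N := \<Sum>i<?n. y i))"
    proof (rule alternant_cong)
      fix t assume t: "t < length es"
      have "(\<Sum>j\<in>{N..<N + ?n}. indet j) = (\<Sum>i<?n. y i)"
        unfolding y_def by (rule sum.reindex_bij_witness[of _ "\<lambda>i. N + i" "\<lambda>j. j - N"]) auto
      then show "(\<Sum>j\<in>set (?B t). indet j) = (x(N := \<Sum>i<?n. y i)) t"
        using t es by (auto simp: x_def less_Suc_eq simp del: sum.lessThan_Suc upt_Suc add_Suc_right)
    qed
    also have "(\<Prod>t<?n. ?Q t) = alternant es y" by simp
    finally show ?thesis .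
  qed
  have rhs: "?W (bs[i := ?W (as @ [bs ! i])]) =
      dpoly c L (alternant es (y(i := y i + (\<Sum>j<N. x j))) * alternant es (x(N := y i)))"
    if i: "i < ?n" for i
  proof -
    \<comment> \<open>Argument \<open>i\<close> now carries the variables of \<open>as\<close> along
      with its own, whence the shift of \<open>y i\<close> by the sum of the
      \<open>x j\<close>.\<close>
    let ?B = "\<lambda>t. if t = i then [0..<N] @ [N + i] else [N + t]"
    let ?Q = "\<lambda>t. if t = i then alternant es (x(N := y i)) else 1"
    have "?W (bs[i := ?W (as @ [bs ! i])]) = dpoly c L
        (alternant es (\<lambda>t. \<Sum>j\<in>set (?B t). indet j) * (\<Prod>t<?n. ?Q t))"
    proof (rule gen_wronskian_dpoly[OF c])
      show "set L = (\<Union>t<?n. set (?B t))"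
      proof safe
        fix j assume j: "j \<in> set L"
        show "j \<in> (\<Union>t<?n. set (?B t))"
        proof (cases "j < N")
          case True
          then show ?thesis using i by (intro UN_I[of i]) auto
        next
          case False
          then show ?thesis using j by (intro UN_I[of "j - N"]) (auto simp: L_def)
        qed
      qed (use i in \<open>auto simp: L_def split: if_splits\<close>)
      show "vars_in (?Q t) (set (?B t))" if "t < ?n" for t
        using that es by (auto simp: vars_in_one x_def y_def intro!: vars_in_alternant vars_in_indet)
    qed (use es ab cb Wa i in \<open>auto simp: L_def nth_list_update\<close>)
    also have "alternant es (\<lambda>t. \<Sum>j\<in>set (?B t). indet j) = alternant es (y(i := y i + (\<Sum>j<N. x j)))"
    proof (rule alternant_cong)
      fix t
      show "(\<Sum>j\<in>set (?B t). indet j) = (y(i := y i + (\<Sum>j<N. x j))) t"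
        by (auto simp: x_def y_def atLeast0LessThan)
    qed
    also have "(\<Prod>t<?n. ?Q t) = alternant es (x(N := y i))" using i by (simp del: prod.lessThan_Suc)
    finally show ?thesis .
  qed
  obtain h where h: "alternant_defect es x y = of_nat p * h" using dvd by blast
  let ?R = "\<lambda>i. alternant es (y(i := y i + (\<Sum>j<N. x j))) * alternant es (x(N := y i))"
  have "alternant es (x(N := \<Sum>i<?n. y i)) * alternant es y = of_nat p * h + (\<Sum>i<?n. ?R i)"
    unfolding h[symmetric] alternant_defect_def es by simp
  then have "?W (as @ [?W bs]) = dpoly c L (of_nat p * h + (\<Sum>i<?n. ?R i))"
    unfolding lhs by simp
  also have "\<dots> = (\<Oplus>\<^bsub>U\<^esub>i\<in>{..<?n}. dpoly c L (?R i))"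
    unfolding dpoly_add[OF c] dpoly_of_nat_mult[OF c] p[OF dpoly_closed[OF c]] dpoly_sum[OF c finite_lessThan]
    by (rule M.l_zero) (auto intro!: M.finsum_closed dpoly_closed c)
  also have "\<dots> = (\<Oplus>\<^bsub>U\<^esub>i\<in>{..<?n}. ?W (bs[i := ?W (as @ [bs ! i])]))"
    by (rule M.finsum_cong') (auto simp: rhs simp del: fun_upd_apply intro!: dpoly_closed c)
  finally show ?thesis .
qed

text \<open>The value \<open>p = 0\<close> is allowed: divisibility by 0 then says that the defect
  vanishes identically, which serves characteristic 0.\<close>

theorem n_Lie_gen_wronskian:
  assumes "\<And>x. x \<in> carrier U \<Longrightarrow> [p] \<cdot>\<^bsub>U\<^esub> x = \<zero>\<^bsub>U\<^esub>" "es \<noteq> []"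
    and "\<And>x y :: nat \<Rightarrow> (nat \<Rightarrow>\<^sub>0 nat) \<Rightarrow>\<^sub>0 int. of_nat p dvd alternant_defect es x y"
    and n: "length es = n"
  shows "n_Lie_multiplication K U n (gen_wronskian U d es)"
proof -
  obtain N where N: "length es = Suc N" using assms(2) by (cases es) auto
  show ?thesis
    using n_linear_gen_wronskian[OF assms(2)] alternating_gen_wronskian[of es]
      gen_wronskian_jacobi[OF assms(1) N assms(3)]
    unfolding n_Lie_multiplication_def n[symmetric] N by (auto simp: Let_def)
qed

end

section \<open>The characteristic as an annihilator, and sums of Wronskians that vanish\<close>

lemma (in assoc_comm_algebra) add_pow_ring_char:
  assumes "x \<in> carrier U"
  shows "[ring_char K] \<cdot>\<^bsub>U\<^esub> x = \<zero>\<^bsub>U\<^esub>"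
proof -
  have scal: "[n] \<cdot>\<^bsub>U\<^esub> x = ([n] \<cdot>\<^bsub>K\<^esub> \<one>\<^bsub>K\<^esub>) \<odot>\<^bsub>U\<^esub> x" for n :: nat
    by (induction n) (use assms in \<open>simp_all add: smult_l_distr\<close>)
  show ?thesis
  proof (cases "\<exists>n::nat. n > 0 \<and> [n] \<cdot>\<^bsub>K\<^esub> \<one>\<^bsub>K\<^esub> = \<zero>\<^bsub>K\<^esub>")
    case True
    then have "[ring_char K] \<cdot>\<^bsub>K\<^esub> \<one>\<^bsub>K\<^esub> = \<zero>\<^bsub>K\<^esub>"
      unfolding ring_char_def by (simp only: if_True) (rule LeastI2_ex, auto)
    then show ?thesis using assms by (simp add: scal)
  next
    case False
    then have "ring_char K = 0" unfolding ring_char_def by (simp only: if_False)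
    then show ?thesis by simp
  qed
qed

lemma (in assoc_comm_algebra) n_Lie_zero:
  assumes zero: "\<And>us. us \<in> tuples U (Suc N) \<Longrightarrow> \<omega> us = \<zero>\<^bsub>U\<^esub>"
  shows "n_Lie_multiplication K U (Suc N) \<omega>"
proof -
  have upd: "us[i := x] \<in> tuples U (Suc N)" if "us \<in> tuples U (Suc N)" "x \<in> carrier U" for us i x
    using that set_update_subset_insert[of us i x] by (auto simp: tuples_def)
  have app: "as @ [x] \<in> tuples U (Suc N)" if "as \<in> tuples U N" "x \<in> carrier U" for as x
    using that by (auto simp: tuples_def)
  have nth: "bs ! i \<in> carrier U" if "bs \<in> tuples U (Suc N)" "i < Suc N" for bs i
    using that by (auto simp: tuples_def)
  have "(\<Oplus>\<^bsub>U\<^esub>i\<in>{..<Suc N}. \<omega> (bs[i := \<omega> (as @ [bs ! i])])) = \<zero>\<^bsub>U\<^esub>"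
    if "as \<in> tuples U N" "bs \<in> tuples U (Suc N)" for as bs
    by (rule M.add.finprod_one_eqI) (use that in \<open>simp add: zero app nth upd\<close>)
  then show ?thesis
    unfolding n_Lie_multiplication_def n_linear_def alternating_def
    using upd by (auto simp: zero app)
qed

text \<open>Reflection exchanges the two halves of the range and has no fixed point, so the terms
  cancel in pairs. Pairing is safe in characteristic 2, where equality of the sum with its negative
  would prove nothing.\<close>

lemma (in abelian_group) finsum_antisymmetric:
  assumes f: "f \<in> {1..2 * h} \<rightarrow> carrier G"
    and anti: "\<And>i. i \<in> {1..2 * h} \<Longrightarrow> f i \<oplus> f (2 * h + 1 - i) = \<zero>"
  shows "(\<Oplus>i\<in>{1..2 * h::nat}. f i) = \<zero>"
proof -
  have "(\<Oplus>i\<in>{1..2 * h}. f i) = (\<Oplus>i\<in>{1..h} \<union> {h + 1..2 * h}. f i)"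
    by (rule arg_cong[of _ _ "finsum G f"]) auto
  also have "\<dots> = (\<Oplus>i\<in>{1..h}. f i) \<oplus> (\<Oplus>i\<in>{h + 1..2 * h}. f i)"
    by (rule finsum_Un_disjoint) (use f in auto)
  also have "{h + 1..2 * h} = (\<lambda>i. 2 * h + 1 - i) ` {1..h}"
  proof safe
    fix i assume "i \<in> {h + 1..2 * h}"
    then show "i \<in> (\<lambda>i. 2 * h + 1 - i) ` {1..h}" by (intro image_eqI[of _ _ "2 * h + 1 - i"]) auto
  qed auto
  also have "finsum G f \<dots> = (\<Oplus>i\<in>{1..h}. f (2 * h + 1 - i))"
    by (rule finsum_reindex) (auto simp: inj_on_def intro!: funcset_mem[OF f])
  also have "(\<Oplus>i\<in>{1..h}. f i) \<oplus> \<dots> = (\<Oplus>i\<in>{1..h}. f i \<oplus> f (2 * h + 1 - i))"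
    by (rule finsum_addf[symmetric]) (auto intro!: funcset_mem[OF f])
  also have "\<dots> = (\<Oplus>i\<in>{1..h}. \<zero>)"
    by (rule finsum_cong') (use anti in auto)
  finally show ?thesis by simp
qed

context differential_algebra
begin

lemma gen_wronskian_cancel:
  assumes "us \<in> tuples U (length es)" "es \<noteq> []" "length fs = length es"
    and "alternant es indet + alternant fs indet = 0"
  shows "gen_wronskian U d es us \<oplus>\<^bsub>U\<^esub> gen_wronskian U d fs us = \<zero>\<^bsub>U\<^esub>"
proof -
  have c: "env us j \<in> carrier U" for j
    using assms(1) by (intro env_closed) (auto simp: tuples_def)
  have "fs \<noteq> []" using assms(2,3) by auto
  then have "gen_wronskian U d es us \<oplus>\<^bsub>U\<^esub> gen_wronskian U d fs us =
      dpoly (env us) [0..<length es] (alternant es indet + alternant fs indet)"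
    using assms(1-3) by (simp add: gen_wronskian_eq_dpoly dpoly_add[OF c])
  then show ?thesis using assms(4) dpoly_zero[OF c] by simp
qed

text \<open>Reflecting \<open>i\<close> swaps the two exponents and so changes the sign of the
  alternant; \<open>l > 0\<close> makes the number of terms even.\<close>

lemma finsum_gen_wronskian_2:
  assumes "l > 0" "us \<in> tuples U 2"
  shows "(\<Oplus>\<^bsub>U\<^esub>i\<in>{1..2 ^ l}. gen_wronskian U d [i, 2 ^ l + 1 - i] us) = \<zero>\<^bsub>U\<^esub>"
proof -
  obtain h :: nat where h: "2 ^ l = 2 * h" using assms(1) by (cases l) auto
  show ?thesis unfolding h
  proof (rule M.finsum_antisymmetric)
    show "(\<lambda>i. gen_wronskian U d [i, 2 * h + 1 - i] us) \<in> {1..2 * h} \<rightarrow> carrier U"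
      using assms(2) by (auto intro!: gen_wronskian_closed simp: eval_nat_numeral)
    fix i assume "i \<in> {1..2 * h}"
    then have "2 * h + 1 - (2 * h + 1 - i) = i" by auto
    then show "gen_wronskian U d [i, 2 * h + 1 - i] us \<oplus>\<^bsub>U\<^esub>
        gen_wronskian U d [2 * h + 1 - i, 2 * h + 1 - (2 * h + 1 - i)] us = \<zero>\<^bsub>U\<^esub>"
      using assms(2) by (simp only:) (rule gen_wronskian_cancel, auto simp: alternant_2 eval_nat_numeral)
  qed
qed

lemma finsum_gen_wronskian_3:
  assumes "l > 0" "us \<in> tuples U 3"
  shows "(\<Oplus>\<^bsub>U\<^esub>i\<in>{1..2 ^ l}. gen_wronskian U d [0, i, 2 ^ l + 1 - i] us) = \<zero>\<^bsub>U\<^esub>"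
proof -
  obtain h :: nat where h: "2 ^ l = 2 * h" using assms(1) by (cases l) auto
  show ?thesis unfolding h
  proof (rule M.finsum_antisymmetric)
    show "(\<lambda>i. gen_wronskian U d [0, i, 2 * h + 1 - i] us) \<in> {1..2 * h} \<rightarrow> carrier U"
      using assms(2) by (auto intro!: gen_wronskian_closed simp: eval_nat_numeral)
    fix i assume "i \<in> {1..2 * h}"
    then have "2 * h + 1 - (2 * h + 1 - i) = i" by auto
    then show "gen_wronskian U d [0, i, 2 * h + 1 - i] us \<oplus>\<^bsub>U\<^esub>
        gen_wronskian U d [0, 2 * h + 1 - i, 2 * h + 1 - (2 * h + 1 - i)] us = \<zero>\<^bsub>U\<^esub>"
      using assms(2) by (simp only:) (rule gen_wronskian_cancel, auto simp: alternant_3 eval_nat_numeral)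
  qed
qed

end

section \<open>Failure in characteristic 0\<close>

lemma vandermonde_nonzero:
  fixes z :: "nat \<Rightarrow> 'a::idom"
  assumes "inj_on z {..<n}"
  shows "alternant [0..<n] z \<noteq> 0"
  using assms
proof (induction n)
  case 0
  show ?case by simp
next
  case (Suc n)
  then have "alternant [0..<n] z \<noteq> 0" by (simp add: inj_on_subset lessThan_Suc)
  moreover have "z n \<noteq> z j" if "j < n" for j
    using Suc.prems that by (auto dest: inj_onD)
  ultimately show ?case by (simp add: vandermonde_Suc del: upt_Suc)
qed

lemma vandermonde_eq_zero:
  fixes z :: "nat \<Rightarrow> 'a::idom"
  assumes "i < n" "z i = z n"
  shows "alternant [0..<Suc n] z = 0"
  using assms by (auto simp: vandermonde_Suc simp del: upt_Suc intro!: bexI[of _ i])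

text \<open>The nodes \<open>y\<close> agree with the roots \<open>x\<close> except for \<open>k\<close> and \<open>k + s\<close>, so all terms of the
  defect but two vanish.\<close>

lemma vandermonde_defect_nonzero:
  fixes k :: nat and x y :: "nat \<Rightarrow> int"
  assumes k: "k \<ge> 2"
  defines "s \<equiv> \<Sum>j<k. int j"
  assumes x: "\<And>j. j < k \<Longrightarrow> x j = int j"
    and y: "\<And>i. i < k - 1 \<Longrightarrow> y i = int i" "y (k - 1) = int k" "y k = int k + s"
  shows "alternant_defect [0..<Suc k] x y \<noteq> 0"
proof -
  obtain m where m: "k = Suc m" "m > 0" using k by (cases k) auto
  \<comment> \<open>The summand for \<open>j = 1\<close> is present because
    \<open>k \<ge> 2\<close>.\<close>
  have s: "s > 0"
  proof -
    have "int 1 \<le> s" unfolding s_def by (rule member_le_sum) (use k in auto)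
    then show ?thesis by simp
  qed
  have xs: "(\<Sum>j<k. x j) = s" unfolding s_def by (rule sum.cong) (auto simp: x)
  have ys: "(\<Sum>i<Suc k. y i) = 2 * s + int k + 1"
  proof -
    have "(\<Sum>i<m. y i) = (\<Sum>i<m. int i)" by (rule sum.cong) (use y m in auto)
    then show ?thesis using y m by (simp add: s_def)
  qed
  define V C where "V = alternant [0..<k] x" and "C = alternant [0..<k] y"
  have V: "V \<noteq> 0" unfolding V_def
    by (rule vandermonde_nonzero) (auto simp: inj_on_def x)
  have C: "C \<noteq> 0" unfolding C_def
    by (rule vandermonde_nonzero) (use y m in \<open>auto simp: inj_on_def less_Suc_eq\<close>)
  have Q: "alternant [0..<Suc k] (x(k := t)) = V * (\<Prod>j<k. t - int j)" for t
    using alternant_interval_last[of 0 k x t] x by (simp add: V_def)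
  have R: "alternant [0..<Suc k] (y(k := t)) = C * ((\<Prod>j<m. t - int j) * (t - int k))" for t
    using alternant_interval_last[of 0 k y t] y m by (simp add: C_def)
  have root: "(\<Prod>j<k. int i - int j) = 0" if "i < k" for i
    using that by (intro prod_zero) auto
  \<comment> \<open>For \<open>i < k - 1\<close> the node \<open>y i\<close> is a root of the
    alternant in \<open>x\<close>; for \<open>i = k - 1\<close> the shifted node
    \<open>k + s\<close> collides with \<open>y k\<close>.\<close>
  have terms: "alternant [0..<Suc k] (y(i := y i + s)) * alternant [0..<Suc k] (x(k := y i)) = 0"
    if "i < k" for i
  proof (cases "i = k - 1")
    case True
    then have "alternant [0..<Suc k] (y(i := y i + s)) = 0"
      by (intro vandermonde_eq_zero[of i]) (use y that in auto)
    then show ?thesis by simp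
  next
    case False
    then show ?thesis unfolding Q using y(1)[of i] root[OF that] that by simp
  qed
  then have rest: "(\<Sum>i<k. alternant [0..<Suc k] (y(i := y i + s)) * alternant [0..<Suc k] (x(k := y i))) = 0"
    by (intro sum.neutral) auto
  \<comment> \<open>\<open>A\<close> collects factors at \<open>k + s\<close>, \<open>B\<close>
    those at \<open>k + 2 * s\<close>; both surviving products contain \<open>A * B\<close>.\<close>
  define A B where "A = (\<Prod>j<m. int k + s - int j)" and "B = (\<Prod>j<m. 2 * s + int k - int j)"
  have "(\<Prod>j<k. 2 * s + int k + 1 - int j) = (2 * s + int k + 1) * B"
    unfolding m(1) B_def
    by (subst prod.lessThan_Suc_shift) (simp add: m(1) algebra_simps)
  then have Q1: "alternant [0..<Suc k] (x(k := \<Sum>i<Suc k. y i)) = V * ((2 * s + int k + 1) * B)"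
    unfolding Q ys by simp
  have Q2: "alternant [0..<Suc k] (x(k := y k)) = V * (A * (s + 1))"
    unfolding Q y(3) A_def by (simp add: m(1))
  have R1: "alternant [0..<Suc k] y = C * (A * s)"
    using R[of "y k"] unfolding fun_upd_triv by (simp add: y(3) A_def)
  have R2: "alternant [0..<Suc k] (y(k := y k + s)) = C * (B * (2 * s))"
    unfolding R y(3) B_def by (simp add: algebra_simps)
  have "alternant_defect [0..<Suc k] x y =
      V * ((2 * s + int k + 1) * B) * (C * (A * s)) - C * (B * (2 * s)) * (V * (A * (s + 1)))"
    by (simp add: alternant_defect_def xs Q1 Q2 R1 R2 del: upt_Suc sum.lessThan_Suc fun_upd_apply)
      (subst sum.lessThan_Suc, simp add: rest Q2 R2 del: upt_Suc fun_upd_apply)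
  \<comment> \<open>The last factor is \<open>(2 * s + k + 1) - 2 * (s + 1)\<close>, which vanishes
    exactly in the Lie case \<open>k = 1\<close>.\<close>
  also have "\<dots> = V * C * A * B * s * (int k - 1)" by (simp add: algebra_simps)
  also have "\<dots> \<noteq> 0"
  proof -
    have "A \<noteq> 0" "B \<noteq> 0" using s m(1) by (auto simp: A_def B_def)
    then show ?thesis using V C s k by simp
  qed
  finally show ?thesis .
qed

section \<open>Polynomials in one variable with the Euler derivation\<close>

context field
begin

text \<open>The polynomial ring repackaged as a module record, with scalars acting through constant
  polynomials. Elements are coefficient lists, which explains the type \<open>'k list\<close> in the
  negative part of the theorem.\<close>

definition poly_algebra :: "('a, 'a list) module" where
  "poly_algebra = \<lparr>carrier = carrier ((carrier R)[X]), monoid.mult = monoid.mult ((carrier R)[X]),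
     monoid.one = monoid.one ((carrier R)[X]), ring.zero = ring.zero ((carrier R)[X]), ring.add = ring.add ((carrier R)[X]),
     module.smult = (\<lambda>a p. monoid.mult ((carrier R)[X]) (poly_of_const a) p)\<rparr>"

lemma poly_algebra_simps:
  "carrier poly_algebra = carrier ((carrier R)[X])"
  "monoid.mult poly_algebra = monoid.mult ((carrier R)[X])"
  "monoid.one poly_algebra = monoid.one ((carrier R)[X])"
  "ring.zero poly_algebra = ring.zero ((carrier R)[X])"
  "ring.add poly_algebra = ring.add ((carrier R)[X])"
  "module.smult poly_algebra a p = monoid.mult ((carrier R)[X]) (poly_of_const a) p"
  by (simp_all add: poly_algebra_def)

lemma algebra_poly_algebra: "algebra R poly_algebra"
proof -
  interpret P: domain "(carrier R)[X]" by (rule univ_poly_is_domain[OF carrier_is_subring])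
  interpret c: ring_hom_ring R "(carrier R)[X]" poly_of_const
    using canonical_embedding_ring_hom[OF carrier_is_subring] by simp
  show ?thesis
  proof (rule algebraI)
    show "cring poly_algebra"
    proof (intro cringI abelian_groupI comm_monoidI)
      fix x assume "x \<in> carrier poly_algebra"
      then show "\<exists>y\<in>carrier poly_algebra. y \<oplus>\<^bsub>poly_algebra\<^esub> x = \<zero>\<^bsub>poly_algebra\<^esub>"
        unfolding poly_algebra_simps by (intro bexI[of _ "\<ominus>\<^bsub>(carrier R)[X]\<^esub> x"]) (auto simp: P.l_neg)
    qed (unfold poly_algebra_simps, auto intro: P.a_assoc P.a_comm P.m_assoc P.m_comm P.l_distr)
  qed (auto simp: poly_algebra_simps P.l_distr P.r_distr P.m_assoc is_cring)
qed

text \<open>This is \<open>X d/dX\<close>. Lists start with the leading coefficient, hence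
  \<open>rev\<close>; \<open>normalize\<close> removes leading zeros that the factors
  \<open>i\<close> create.\<close>

definition euler_derivation :: "'a list \<Rightarrow> 'a list" where
  "euler_derivation p = normalize (map (\<lambda>i. [i] \<cdot>\<^bsub>R\<^esub> coeff p i) (rev [0..<length p]))"

lemma poly_carrier: "p \<in> carrier ((carrier R)[X]) \<Longrightarrow> set p \<subseteq> carrier R"
  using polynomial_incl univ_poly_carrier by blast

lemma euler_derivation_coeff: "coeff (euler_derivation p) i = [i] \<cdot>\<^bsub>R\<^esub> coeff p i"
proof -
  let ?l = "map (\<lambda>i. [i] \<cdot>\<^bsub>R\<^esub> coeff p i) (rev [0..<length p])"
  have "coeff (euler_derivation p) i = coeff ?l i"
    unfolding euler_derivation_def normalize_coeff[symmetric] ..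
  also have "\<dots> = [i] \<cdot>\<^bsub>R\<^esub> coeff p i"
  proof (cases "i < length p")
    case True
    then have i: "rev [0..<length p] ! (length p - Suc i) = i" by (subst rev_nth) auto
    have "coeff ?l i = (\<lambda>i. [i] \<cdot>\<^bsub>R\<^esub> coeff p i) (rev [0..<length p] ! (length p - Suc i))"
      using True by (simp add: coeff_nth[of i ?l])
    then show ?thesis unfolding i .
  qed (simp add: coeff_length)
  finally show ?thesis .
qed

lemma euler_derivation_closed:
  assumes "p \<in> carrier ((carrier R)[X])"
  shows "euler_derivation p \<in> carrier ((carrier R)[X])"
  unfolding univ_poly_carrier[symmetric] euler_derivation_def
  using poly_carrier[OF assms] by (intro normalize_gives_polynomial) auto

lemma poly_eqI:
  assumes "p \<in> carrier ((carrier R)[X])" "q \<in> carrier ((carrier R)[X])" "\<And>i. coeff p i = coeff q i"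
  shows "p = q"
  using assms coeff_iff_polynomial_cond[of "carrier R" p q] unfolding univ_poly_carrier by blast

lemma coeff_univ_poly_add:
  assumes "a \<in> carrier ((carrier R)[X])" "b \<in> carrier ((carrier R)[X])"
  shows "coeff (a \<oplus>\<^bsub>(carrier R)[X]\<^esub> b) i = coeff a i \<oplus> coeff b i"
  unfolding univ_poly_add using assms by (simp add: poly_add_coeff poly_carrier del: poly_add.simps)

text \<open>In the convolution for coefficient \<open>i\<close> the factor \<open>i\<close> is split
  as \<open>k + (i - k)\<close>.\<close>

lemma euler_derivation_mult:
  assumes p: "p \<in> carrier ((carrier R)[X])" and q: "q \<in> carrier ((carrier R)[X])"
  shows "euler_derivation (p \<otimes>\<^bsub>(carrier R)[X]\<^esub> q) =
    euler_derivation p \<otimes>\<^bsub>(carrier R)[X]\<^esub> q \<oplus>\<^bsub>(carrier R)[X]\<^esub> p \<otimes>\<^bsub>(carrier R)[X]\<^esub> euler_derivation q"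
proof -
  interpret P: domain "(carrier R)[X]" by (rule univ_poly_is_domain[OF carrier_is_subring])
  note cl = euler_derivation_closed[OF p] euler_derivation_closed[OF q]
  have [simp]: "coeff p i \<in> carrier R" "coeff q i \<in> carrier R" for i
    using poly_carrier[OF p] poly_carrier[OF q] by simp_all
  have mult: "coeff (a \<otimes>\<^bsub>(carrier R)[X]\<^esub> b) i = (\<Oplus>k\<in>{..i}. coeff a k \<otimes> coeff b (i - k))"
    if "a \<in> carrier ((carrier R)[X])" "b \<in> carrier ((carrier R)[X])" for a b i
    unfolding univ_poly_mult using that by (simp add: poly_mult_coeff poly_carrier)
  show ?thesis
  proof (rule poly_eqI)
    fix i
    have "coeff (euler_derivation (p \<otimes>\<^bsub>(carrier R)[X]\<^esub> q)) i =
        ([i] \<cdot> \<one>) \<otimes> (\<Oplus>k\<in>{..i}. coeff p k \<otimes> coeff q (i - k))"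
      by (simp add: euler_derivation_coeff mult[OF p q] add_pow_ldistr)
    also have "\<dots> = (\<Oplus>k\<in>{..i}. ([i] \<cdot> \<one>) \<otimes> (coeff p k \<otimes> coeff q (i - k)))"
      by (rule finsum_rdistr) auto
    also have "\<dots> = (\<Oplus>k\<in>{..i}. ([k] \<cdot> coeff p k) \<otimes> coeff q (i - k) \<oplus>
        coeff p k \<otimes> add_pow R (i - k) (coeff q (i - k)))"
    proof (rule finsum_cong')
      fix k assume "k \<in> {..i}"
      then have split: "[i] \<cdot> x = [k] \<cdot> x \<oplus> add_pow R (i - k) x" if "x \<in> carrier R" for x
        using that by (simp add: add.nat_pow_mult)
      have "([i] \<cdot> \<one>) \<otimes> (coeff p k \<otimes> coeff q (i - k)) = [i] \<cdot> (coeff p k \<otimes> coeff q (i - k))"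
        by (simp add: add_pow_ldistr)
      also note split
      finally show "([i] \<cdot> \<one>) \<otimes> (coeff p k \<otimes> coeff q (i - k)) =
          ([k] \<cdot> coeff p k) \<otimes> coeff q (i - k) \<oplus> coeff p k \<otimes> add_pow R (i - k) (coeff q (i - k))"
        by (simp add: add_pow_ldistr add_pow_rdistr)
    qed auto
    also have "\<dots> = (\<Oplus>k\<in>{..i}. ([k] \<cdot> coeff p k) \<otimes> coeff q (i - k)) \<oplus>
        (\<Oplus>k\<in>{..i}. coeff p k \<otimes> add_pow R (i - k) (coeff q (i - k)))"
      by (rule finsum_addf) auto
    also have "\<dots> = coeff (euler_derivation p \<otimes>\<^bsub>(carrier R)[X]\<^esub> q \<oplus>\<^bsub>(carrier R)[X]\<^esub>
        p \<otimes>\<^bsub>(carrier R)[X]\<^esub> euler_derivation q) i"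
      using p q cl by (simp add: coeff_univ_poly_add mult euler_derivation_coeff)
    finally show "coeff (euler_derivation (p \<otimes>\<^bsub>(carrier R)[X]\<^esub> q)) i = \<dots>" .
  qed (use p q cl in \<open>auto intro: euler_derivation_closed\<close>)
qed

text \<open>Homogeneity over the field follows from the product rule, because constant polynomials
  are mapped to zero.\<close>

lemma derivation_euler: "derivation R poly_algebra euler_derivation"
proof -
  interpret P: domain "(carrier R)[X]" by (rule univ_poly_is_domain[OF carrier_is_subring])
  interpret c: ring_hom_ring R "(carrier R)[X]" poly_of_const
    using canonical_embedding_ring_hom[OF carrier_is_subring] by simp
  have add: "euler_derivation (p \<oplus>\<^bsub>(carrier R)[X]\<^esub> q) =
      euler_derivation p \<oplus>\<^bsub>(carrier R)[X]\<^esub> euler_derivation q"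
    if "p \<in> carrier ((carrier R)[X])" "q \<in> carrier ((carrier R)[X])" for p q
    by (rule poly_eqI)
      (use that in \<open>auto simp: coeff_univ_poly_add poly_carrier euler_derivation_coeff
         add.nat_pow_distrib euler_derivation_closed\<close>)
  have const: "euler_derivation (poly_of_const a) = \<zero>\<^bsub>(carrier R)[X]\<^esub>" if "a \<in> carrier R" for a
  proof (rule poly_eqI)
    fix i
    have "coeff (poly_of_const a) i = coeff [a] i"
      unfolding poly_of_const_def normalize_coeff[symmetric] ..
    then show "coeff (euler_derivation (poly_of_const a)) i = coeff \<zero>\<^bsub>(carrier R)[X]\<^esub> i"
      by (auto simp: euler_derivation_coeff univ_poly_zero)
  qed (use that in \<open>auto intro: euler_derivation_closed\<close>)
  show ?thesis
    unfolding derivation_def poly_algebra_simps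
    using add const by (auto simp: euler_derivation_mult euler_derivation_closed)
qed

abbreviation power_basis :: "nat \<Rightarrow> 'a list" where
  "power_basis g \<equiv> monom \<one> g"

lemma power_basis_closed: "power_basis g \<in> carrier poly_algebra"
  unfolding poly_algebra_simps unitary_monom_eq_var_pow[OF carrier_is_subring]
  by (rule var_pow_closed[OF carrier_is_subring])

lemma power_basis_mult: "power_basis g \<otimes>\<^bsub>poly_algebra\<^esub> power_basis h = power_basis (g + h)"
proof -
  interpret P: domain "(carrier R)[X]" by (rule univ_poly_is_domain[OF carrier_is_subring])
  show ?thesis
    unfolding poly_algebra_simps unitary_monom_eq_var_pow[OF carrier_is_subring]
    by (rule P.nat_pow_mult) (rule var_closed(1)[OF carrier_is_subring])
qed

lemma coeff_smult:
  assumes "a \<in> carrier R" "p \<in> carrier poly_algebra"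
  shows "coeff (a \<odot>\<^bsub>poly_algebra\<^esub> p) i = a \<otimes> coeff p i"
proof (cases "a = \<zero>")
  case True
  then show ?thesis using assms poly_carrier
    by (simp add: poly_algebra_simps poly_of_const_def univ_poly_mult)
next
  case False
  then have "a \<odot>\<^bsub>poly_algebra\<^esub> p = map (\<lambda>b. a \<otimes> b) p"
    using assms poly_mult_const(1)[OF carrier_is_subring, of p a]
    unfolding poly_algebra_simps univ_poly_mult univ_poly_carrier[symmetric]
    by (simp add: poly_of_const_def)
  then show ?thesis using assms(1) by (simp add: scalar_coeff)
qed

lemma power_basis_eigenvector:
  "euler_derivation (power_basis g) = ([g] \<cdot>\<^bsub>R\<^esub> \<one>) \<odot>\<^bsub>poly_algebra\<^esub> power_basis g"
proof -
  interpret A: algebra R poly_algebra by (rule algebra_poly_algebra)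
  show ?thesis
  proof (rule poly_eqI)
    show "coeff (euler_derivation (power_basis g)) i =
        coeff (([g] \<cdot> \<one>) \<odot>\<^bsub>poly_algebra\<^esub> power_basis g) i" for i
      by (simp add: euler_derivation_coeff coeff_smult power_basis_closed monom_coeff)
  qed (use power_basis_closed[of g] A.smult_closed[of "[g] \<cdot> \<one>" "power_basis g"] in
      \<open>auto intro: euler_derivation_closed simp: poly_algebra_simps\<close>)
qed

lemma smult_power_basis_inject:
  assumes "a \<in> carrier R" "b \<in> carrier R"
    "a \<odot>\<^bsub>poly_algebra\<^esub> power_basis g = b \<odot>\<^bsub>poly_algebra\<^esub> power_basis g"
  shows "a = b"
proof -
  have "coeff (c \<odot>\<^bsub>poly_algebra\<^esub> power_basis g) g = c" if "c \<in> carrier R" for c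
    using that by (simp add: coeff_smult power_basis_closed monom_coeff)
  then show ?thesis by (metis assms)
qed

end

section \<open>Wronskians of a multiplicative family of eigenvectors\<close>

context differential_algebra
begin

abbreviation int_scalar :: "int \<Rightarrow> 'k" where
  "int_scalar z \<equiv> add_pow K z \<one>\<^bsub>K\<^esub>"

lemma int_scalar_mult: "int_scalar (a * b) = int_scalar a \<otimes>\<^bsub>K\<^esub> int_scalar b"
proof -
  have "int_scalar a \<otimes>\<^bsub>K\<^esub> int_scalar b = add_pow K b (add_pow K a \<one>\<^bsub>K\<^esub>)"
    by (simp add: R.add_pow_rdistr_int)
  also have "\<dots> = int_scalar (a * b)" by (rule R.add.int_pow_pow) simp
  finally show ?thesis by simp
qed

lemma int_scalar_minus: "int_scalar (- a) = \<ominus>\<^bsub>K\<^esub> int_scalar a"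
  by (rule R.add.int_pow_neg) simp

lemma finsum_int_scalar:
  assumes "finite S" "x \<in> carrier U"
  shows "(\<Oplus>\<^bsub>U\<^esub>i\<in>S. int_scalar (f i) \<odot>\<^bsub>U\<^esub> x) = int_scalar (\<Sum>i\<in>S. f i) \<odot>\<^bsub>U\<^esub> x"
  using assms(1)
proof (induction S rule: finite_induct)
  case empty
  show ?case using assms(2) by (simp add: add_pow_def)
next
  case (insert i S)
  have "int_scalar (f i + (\<Sum>i\<in>S. f i)) = int_scalar (f i) \<oplus>\<^bsub>K\<^esub> int_scalar (\<Sum>i\<in>S. f i)"
    by (rule R.add.int_pow_mult) simp
  then show ?case using insert assms(2) by (simp add: smult_l_distr)
qed

context
  fixes e :: "nat \<Rightarrow> 'u"
  assumes e_closed: "\<And>g. e g \<in> carrier U"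
    and e_mult: "\<And>g h. e g \<otimes>\<^bsub>U\<^esub> e h = e (g + h)"
    and e_eigen: "\<And>g. d (e g) = int_scalar (int g) \<odot>\<^bsub>U\<^esub> e g"
begin

lemma d_pow_eigen: "(d ^^ k) (e g) = int_scalar (int g ^ k) \<odot>\<^bsub>U\<^esub> e g"
proof (induction k)
  case 0
  then show ?case by (simp add: e_closed)
next
  case (Suc k)
  have "(d ^^ Suc k) (e g) = d (int_scalar (int g ^ k) \<odot>\<^bsub>U\<^esub> e g)" by (simp only: funpow.simps comp_apply Suc)
  also have "\<dots> = int_scalar (int g ^ k) \<odot>\<^bsub>U\<^esub> (int_scalar (int g) \<odot>\<^bsub>U\<^esub> e g)"
    using d_pow_smult[of _ "e g" 1] e_eigen by (simp add: e_closed)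
  also have "\<dots> = int_scalar (int g ^ k * int g) \<odot>\<^bsub>U\<^esub> e g"
    by (simp only: int_scalar_mult) (rule smult_assoc1[symmetric], auto simp: e_closed)
  finally show ?case by (simp add: mult.commute)
qed

lemma nonempty_prod_eigen:
  "xs \<noteq> [] \<Longrightarrow> nonempty_prod U (map (\<lambda>s. int_scalar (z s) \<odot>\<^bsub>U\<^esub> e (h s)) xs) =
    int_scalar (prod_list (map z xs)) \<odot>\<^bsub>U\<^esub> e (sum_list (map h xs))"
proof (induction xs)
  case (Cons s xs)
  show ?case
  proof (cases "xs = []")
    case False
    have "nonempty_prod U (map (\<lambda>s. int_scalar (z s) \<odot>\<^bsub>U\<^esub> e (h s)) (s # xs)) =
        (int_scalar (z s) \<odot>\<^bsub>U\<^esub> e (h s)) \<otimes>\<^bsub>U\<^esub>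
        (int_scalar (prod_list (map z xs)) \<odot>\<^bsub>U\<^esub> e (sum_list (map h xs)))"
      using Cons.IH[OF False] False by (simp add: nonempty_prod_Cons)
    also have "\<dots> = int_scalar (z s) \<odot>\<^bsub>U\<^esub> (int_scalar (prod_list (map z xs)) \<odot>\<^bsub>U\<^esub>
        (e (h s) \<otimes>\<^bsub>U\<^esub> e (sum_list (map h xs))))"
      by (simp add: smult_mult e_closed mult_comm[of "e (h s)"])
    also have "\<dots> = int_scalar (z s * prod_list (map z xs)) \<odot>\<^bsub>U\<^esub> e (h s + sum_list (map h xs))"
      by (simp only: int_scalar_mult e_mult) (rule smult_assoc1[symmetric], auto simp: e_closed)
    finally show ?thesis by simp
  qed simp
qed simp

text \<open>Every term of the determinant is a multiple of the same vector
  \<open>e (sum_list gs)\<close>, and the scalars form the Leibniz expansion of the alternant at the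
  eigenvalues.\<close>

lemma gen_wronskian_eigen:
  assumes "length gs = length es" "es \<noteq> []"
  shows "gen_wronskian U d es (map e gs) =
    int_scalar (alternant es (\<lambda>t. int (gs ! t))) \<odot>\<^bsub>U\<^esub> e (sum_list gs)"
proof -
  let ?n = "length es"
  let ?S = "{\<sigma>. \<sigma> permutes {..<?n}}"
  let ?T = "\<lambda>\<sigma>. (\<Prod>s<?n. int (gs ! \<sigma> s) ^ (es ! s))"
  have prd: "nonempty_prod U (map (\<lambda>s. (d ^^ (es ! s)) (map e gs ! \<sigma> s)) [0..<?n]) =
      int_scalar (?T \<sigma>) \<odot>\<^bsub>U\<^esub> e (sum_list gs)"
    if \<sigma>: "\<sigma> permutes {..<?n}" for \<sigma>
  proof -
    have lt: "\<sigma> s < ?n" if "s < ?n" for s using permutes_in_image[OF \<sigma>, of s] that by simp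
    have "map (\<lambda>s. (d ^^ (es ! s)) (map e gs ! \<sigma> s)) [0..<?n] =
        map (\<lambda>s. int_scalar (int (gs ! \<sigma> s) ^ (es ! s)) \<odot>\<^bsub>U\<^esub> e (gs ! \<sigma> s)) [0..<?n]"
      using lt assms(1) by (auto simp: d_pow_eigen)
    then have "nonempty_prod U (map (\<lambda>s. (d ^^ (es ! s)) (map e gs ! \<sigma> s)) [0..<?n]) =
        int_scalar (prod_list (map (\<lambda>s. int (gs ! \<sigma> s) ^ (es ! s)) [0..<?n])) \<odot>\<^bsub>U\<^esub>
        e (sum_list (map (\<lambda>s. gs ! \<sigma> s) [0..<?n]))"
      using assms(2) by (simp only:) (rule nonempty_prod_eigen, simp)
    moreover have "sum_list (map (\<lambda>s. gs ! \<sigma> s) [0..<?n]) = sum_list gs"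
      using sum.permute[OF \<sigma>, of "\<lambda>t. gs ! t"] assms(1)
      by (simp add: interv_sum_list_conv_sum_set_nat sum_list_sum_nth atLeast0LessThan comp_def)
    moreover have "prod_list (map (\<lambda>s. int (gs ! \<sigma> s) ^ (es ! s)) [0..<?n]) = ?T \<sigma>"
      by (simp add: prod.distinct_set_conv_list[symmetric] atLeast0LessThan)
    ultimately show ?thesis by simp
  qed
  have "gen_wronskian U d es (map e gs) =
      (\<Oplus>\<^bsub>U\<^esub>\<sigma>\<in>?S. int_scalar (of_int (sign \<sigma>) * ?T \<sigma>) \<odot>\<^bsub>U\<^esub> e (sum_list gs))"
    unfolding gen_wronskian_def determinant_def
    by (rule M.finsum_cong')
      (auto simp: prd sign_def int_scalar_minus smult_l_minus e_closed)
  also have "\<dots> = int_scalar (\<Sum>\<sigma>\<in>?S. of_int (sign \<sigma>) * ?T \<sigma>) \<odot>\<^bsub>U\<^esub> e (sum_list gs)"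
    by (rule finsum_int_scalar) (auto simp: finite_permutations e_closed)
  finally show ?thesis by (simp add: alternant_expand)
qed

text \<open>On eigenvectors both sides of the n-Lie identity are multiples of \<open>e ?T\<close>.
  By \<open>inject\<close> and \<open>char0\<close> the coefficients may be compared as integers,
  and their difference is the defect at the exponents.\<close>

lemma n_Lie_eigen_defect:
  assumes nL: "n_Lie_multiplication K U (Suc k) (gen_wronskian U d es)"
    and len: "length es = Suc k" "length ga = k" "length gb = Suc k"
    and inject: "\<And>a b g. \<lbrakk>a \<in> carrier K; b \<in> carrier K; a \<odot>\<^bsub>U\<^esub> e g = b \<odot>\<^bsub>U\<^esub> e g\<rbrakk> \<Longrightarrow> a = b"
    and char0: "\<And>z. int_scalar z = \<zero>\<^bsub>K\<^esub> \<Longrightarrow> z = 0"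
  shows "alternant_defect es (\<lambda>j. int (ga ! j)) (\<lambda>i. int (gb ! i)) = 0"
proof -
  let ?W = "gen_wronskian U d es" and ?T = "sum_list ga + sum_list gb"
  define \<Delta> where "\<Delta> gs = alternant es (\<lambda>t. int (gs ! t))" for gs
  have es: "es \<noteq> []" using len(1) by auto
  have W: "?W (map e gs) = int_scalar (\<Delta> gs) \<odot>\<^bsub>U\<^esub> e (sum_list gs)" if "length gs = Suc k" for gs
    using gen_wronskian_eigen[of gs es] that len es by (simp add: \<Delta>_def)
  have pull: "?W ((map e gs)[i := int_scalar z \<odot>\<^bsub>U\<^esub> e g]) =
      int_scalar (z * \<Delta> (gs[i := g])) \<odot>\<^bsub>U\<^esub> e (sum_list (gs[i := g]))"
    if gs: "length gs = Suc k" "i < Suc k" for gs i z g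
  proof -
    have "map e gs \<in> tuples U (Suc k)" using gs by (auto simp: tuples_def e_closed)
    then have "?W ((map e gs)[i := int_scalar z \<odot>\<^bsub>U\<^esub> e g]) = int_scalar z \<odot>\<^bsub>U\<^esub> ?W ((map e gs)[i := e g])"
      using nL gs(2) e_closed by (simp add: n_Lie_multiplication_def n_linear_def)
    also have "(map e gs)[i := e g] = map e (gs[i := g])" by (simp add: map_update)
    also have "?W \<dots> = int_scalar (\<Delta> (gs[i := g])) \<odot>\<^bsub>U\<^esub> e (sum_list (gs[i := g]))"
      using gs by (intro W) simp
    also have "int_scalar z \<odot>\<^bsub>U\<^esub> \<dots> =
        int_scalar (z * \<Delta> (gs[i := g])) \<odot>\<^bsub>U\<^esub> e (sum_list (gs[i := g]))"
      by (simp only: int_scalar_mult) (rule smult_assoc1[symmetric], auto simp: e_closed)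
    finally show ?thesis .
  qed
  have lhs: "?W (map e ga @ [?W (map e gb)]) =
      int_scalar (\<Delta> gb * \<Delta> (ga @ [sum_list gb])) \<odot>\<^bsub>U\<^esub> e ?T"
  proof -
    have "?W (map e ga @ [?W (map e gb)]) =
        ?W ((map e (ga @ [0]))[k := int_scalar (\<Delta> gb) \<odot>\<^bsub>U\<^esub> e (sum_list gb)])"
      using len by (simp add: W list_update_append)
    then show ?thesis using len by (subst (asm) pull) (auto simp: list_update_append)
  qed
  have rhs: "?W ((map e gb)[i := ?W (map e ga @ [map e gb ! i])]) =
      int_scalar (\<Delta> (ga @ [gb ! i]) * \<Delta> (gb[i := sum_list ga + gb ! i])) \<odot>\<^bsub>U\<^esub> e ?T"
    if i: "i < Suc k" for i
  proof -
    have "?W (map e ga @ [map e gb ! i]) = ?W (map e (ga @ [gb ! i]))" using len i by simp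
    also have "\<dots> = int_scalar (\<Delta> (ga @ [gb ! i])) \<odot>\<^bsub>U\<^esub> e (sum_list ga + gb ! i)"
      by (subst W) (use len in auto)
    finally have *: "?W (map e ga @ [map e gb ! i]) = \<dots>" .
    have "sum_list (gb[i := sum_list ga + gb ! i]) = ?T"
      using i len elem_le_sum_list[of i gb] by (simp add: sum_list_update)
    then show ?thesis unfolding * using i len by (subst pull) auto
  qed
  have "map e ga \<in> tuples U k" "map e gb \<in> tuples U (Suc k)"
    using len e_closed by (auto simp: tuples_def)
  then have "?W (map e ga @ [?W (map e gb)]) =
      (\<Oplus>\<^bsub>U\<^esub>i\<in>{..<Suc k}. ?W ((map e gb)[i := ?W (map e ga @ [map e gb ! i])]))"
    using nL by (simp add: n_Lie_multiplication_def Let_def)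
  also have "\<dots> = (\<Oplus>\<^bsub>U\<^esub>i\<in>{..<Suc k}.
      int_scalar (\<Delta> (ga @ [gb ! i]) * \<Delta> (gb[i := sum_list ga + gb ! i])) \<odot>\<^bsub>U\<^esub> e ?T)"
    by (rule M.finsum_cong') (auto simp: rhs e_closed simp del: nth_map)
  also have "\<dots> = int_scalar (\<Sum>i<Suc k. \<Delta> (ga @ [gb ! i]) * \<Delta> (gb[i := sum_list ga + gb ! i])) \<odot>\<^bsub>U\<^esub> e ?T"
    by (rule finsum_int_scalar) (auto simp: e_closed)
  finally have "int_scalar (\<Delta> gb * \<Delta> (ga @ [sum_list gb])) =
      int_scalar (\<Sum>i<Suc k. \<Delta> (ga @ [gb ! i]) * \<Delta> (gb[i := sum_list ga + gb ! i]))" (is "int_scalar ?l = int_scalar ?r")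
    unfolding lhs by (intro inject) auto
  moreover have "int_scalar (?l - ?r) = int_scalar ?l \<ominus>\<^bsub>K\<^esub> int_scalar ?r"
    using R.add.int_pow_diff[of "\<one>\<^bsub>K\<^esub>" ?l ?r] by (simp add: a_minus_def del: sum.lessThan_Suc)
  ultimately have "int_scalar (?l - ?r) = \<zero>\<^bsub>K\<^esub>"
    by (simp add: R.r_right_minus_eq del: sum.lessThan_Suc)
  from char0[OF this] have eq: "?l = ?r" by (simp only: right_minus_eq)
  have sga: "(\<Sum>j<k. int (ga ! j)) = int (sum_list ga)" and sgb: "(\<Sum>i<Suc k. int (gb ! i)) = int (sum_list gb)"
    using len by (simp_all add: sum_list_sum_nth atLeast0LessThan del: sum.lessThan_Suc)
  have "alternant es ((\<lambda>j. int (ga ! j))(k := int t)) = \<Delta> (ga @ [t])" for t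
    unfolding \<Delta>_def by (rule alternant_cong) (use len in \<open>auto simp: nth_append less_Suc_eq\<close>)
  moreover have "alternant es ((\<lambda>i. int (gb ! i))(i := int (gb ! i) + int (sum_list ga))) =
      \<Delta> (gb[i := sum_list ga + gb ! i])" if "i < Suc k" for i
    unfolding \<Delta>_def by (rule alternant_cong) (use len that in \<open>auto simp: nth_list_update\<close>)
  moreover have "alternant es (\<lambda>i. int (gb ! i)) = \<Delta> gb" by (simp add: \<Delta>_def)
  ultimately show ?thesis using eq
    unfolding alternant_defect_def len(1) diff_Suc_1 sga sgb
    by (simp add: mult.commute del: sum.lessThan_Suc fun_upd_apply)
qed

end

end

lemma (in field) int_scalar_eq_zero:
  assumes "ring_char R = 0" "add_pow R (z :: int) \<one> = \<zero>"
  shows "z = 0"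
proof -
  have pos: "[n] \<cdot> \<one> \<noteq> \<zero>" if "n > 0" for n :: nat
  proof
    assume "[n] \<cdot> \<one> = \<zero>"
    with that have ex: "\<exists>n::nat. n > 0 \<and> [n] \<cdot> \<one> = \<zero>" by blast
    then have "ring_char R = (LEAST n::nat. n > 0 \<and> [n] \<cdot> \<one> = \<zero>)"
      by (simp only: ring_char_def if_True)
    then have "ring_char R > 0" using LeastI_ex[OF ex] by simp
    then show False using assms(1) by simp
  qed
  show ?thesis
  proof (cases "z \<ge> 0")
    case True
    then show ?thesis using assms(2) pos[of "nat z"] by (cases "z = 0") (auto simp: add_pow_int_ge)
  next
    case False
    then have "[nat (- z)] \<cdot> \<one> = \<zero>" using assms(2) add_pow_int_lt[of z R \<one>] by simp
    then show ?thesis using False pos[of "nat (- z)"] by simp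
  qed
qed

lemma (in field) wronskian_not_n_Lie:
  assumes "ring_char R = 0" "k \<ge> 2"
  shows "\<not> n_Lie_multiplication R poly_algebra (Suc k) (gen_wronskian poly_algebra euler_derivation [0..<Suc k])"
proof
  assume nL: "n_Lie_multiplication R poly_algebra (Suc k)
    (gen_wronskian poly_algebra euler_derivation [0..<Suc k])"
  interpret D: differential_algebra R poly_algebra euler_derivation
    by (intro differential_algebra.intro algebra_imp_assoc_comm_algebra algebra_poly_algebra
        differential_algebra_axioms.intro derivation_euler)
  define s where "s = (\<Sum>j<k. j)"
  \<comment> \<open>The nodes of \<open>vandermonde_defect_nonzero\<close>, read as exponents of the
    variable.\<close>
  define ga gb where "ga = [0..<k]" and "gb = [0..<k - 1] @ [k, k + s]"
  have "alternant_defect [0..<Suc k] (\<lambda>j. int (ga ! j)) (\<lambda>i. int (gb ! i)) = 0"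
  proof (rule D.n_Lie_eigen_defect[of power_basis, OF _ _ _ nL])
    show "euler_derivation (power_basis g) = add_pow R (int g) \<one> \<odot>\<^bsub>poly_algebra\<^esub> power_basis g" for g
      using power_basis_eigenvector[of g] by (simp add: add_pow_int_ge)
  qed (use assms power_basis_closed power_basis_mult smult_power_basis_inject int_scalar_eq_zero in
      \<open>auto simp: ga_def gb_def\<close>)
  moreover have "alternant_defect [0..<Suc k] (\<lambda>j. int (ga ! j)) (\<lambda>i. int (gb ! i)) \<noteq> 0"
    by (rule vandermonde_defect_nonzero[OF assms(2)])
      (use assms(2) in \<open>auto simp: ga_def gb_def s_def nth_append nth_Cons'\<close>)
  ultimately show False by contradiction
qed

theorem theorem1p2:
  fixes K :: "('k, 'm) ring_scheme" and p :: nat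
  assumes "field K" and "ring_char K = p"
  shows
    "(\<forall>(U :: ('k, 'u) module) d. assoc_comm_algebra K U \<and> derivation K U d \<longrightarrow>
        (p = 2 \<longrightarrow> (\<forall>r l. l \<le> r \<longrightarrow>
           n_Lie_multiplication K U 2 (gen_wronskian U d [2 ^ r - 2 ^ l, 2 ^ r]))) \<and>
        (p = 2 \<longrightarrow> (\<forall>l>0.
           n_Lie_multiplication K U 2
             (\<lambda>us. \<Oplus>\<^bsub>U\<^esub>i\<in>{1..2 ^ l}. gen_wronskian U d [i, 2 ^ l + 1 - i] us))) \<and>
        (p = 3 \<longrightarrow> (\<forall>r.
           n_Lie_multiplication K U 2 (gen_wronskian U d [2 * 3 ^ r, 3 ^ (r + 1)]))) \<and>
        (p = 2 \<longrightarrow> n_Lie_multiplication K U 3 (gen_wronskian U d [1, 2, 4])) \<and>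
        (p = 2 \<longrightarrow> n_Lie_multiplication K U 3 (gen_wronskian U d [2, 3, 4])) \<and>
        (p = 2 \<longrightarrow> (\<forall>l>0.
           n_Lie_multiplication K U 3
             (\<lambda>us. \<Oplus>\<^bsub>U\<^esub>i\<in>{1..2 ^ l}. gen_wronskian U d [0, i, 2 ^ l + 1 - i] us))) \<and>
        (p = 3 \<longrightarrow> n_Lie_multiplication K U 3 (gen_wronskian U d [1, 2, 3])) \<and>
        (p = 2 \<longrightarrow> n_Lie_multiplication K U 4 (gen_wronskian U d [1, 2, 3, 4])) \<and>
        (p = 3 \<longrightarrow> n_Lie_multiplication K U 4 (gen_wronskian U d [0, 1, 2, 3])) \<and>
        (p = 2 \<longrightarrow> n_Lie_multiplication K U 5 (gen_wronskian U d [0, 1, 2, 3, 4])))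
     \<and>
     (p = 0 \<longrightarrow>
        (\<forall>(U :: ('k, 'u) module) d. assoc_comm_algebra K U \<and> derivation K U d \<longrightarrow>
           n_Lie_multiplication K U 2 (gen_wronskian U d [0, 1])) \<and>
        (\<forall>k\<ge>1.
           (\<forall>(U :: ('k, 'k list) module) d. assoc_comm_algebra K U \<and> derivation K U d \<longrightarrow>
              n_Lie_multiplication K U (k + 1) (gen_wronskian U d [0..<k + 1]))
           \<longrightarrow> k = 1))"
proof -
  interpret K: field K by fact
  have nLie: "n_Lie_multiplication K U n (gen_wronskian U d es)"
    if "assoc_comm_algebra K U" "derivation K U d" "length es = n" "es \<noteq> []"
      "\<And>x y :: nat \<Rightarrow> (nat \<Rightarrow>\<^sub>0 nat) \<Rightarrow>\<^sub>0 int. of_nat p dvd alternant_defect es x y"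
    for U :: "('k, 'u) module" and d n es
  proof -
    interpret differential_algebra K U d
      using that(1,2) by (intro differential_algebra.intro differential_algebra_axioms.intro)
    show ?thesis
      by (rule n_Lie_gen_wronskian[of p]) (use that assms(2) add_pow_ring_char in auto)
  qed
  have zero2: "n_Lie_multiplication K U 2
      (\<lambda>us. \<Oplus>\<^bsub>U\<^esub>i\<in>{1..2 ^ l}. gen_wronskian U d [i, 2 ^ l + 1 - i] us)"
    and zero3: "n_Lie_multiplication K U 3
      (\<lambda>us. \<Oplus>\<^bsub>U\<^esub>i\<in>{1..2 ^ l}. gen_wronskian U d [0, i, 2 ^ l + 1 - i] us)"
    if "assoc_comm_algebra K U" "derivation K U d" "l > 0"
    for U :: "('k, 'u) module" and d and l :: nat
  proof -
    interpret differential_algebra K U d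
      using that(1,2) by (intro differential_algebra.intro differential_algebra_axioms.intro)
    have "Suc 1 = 2" "Suc 2 = 3" by simp_all
    then show "n_Lie_multiplication K U 2
        (\<lambda>us. \<Oplus>\<^bsub>U\<^esub>i\<in>{1..2 ^ l}. gen_wronskian U d [i, 2 ^ l + 1 - i] us)"
      "n_Lie_multiplication K U 3
        (\<lambda>us. \<Oplus>\<^bsub>U\<^esub>i\<in>{1..2 ^ l}. gen_wronskian U d [0, i, 2 ^ l + 1 - i] us)"
      using n_Lie_zero[of 1, OF finsum_gen_wronskian_2[OF that(3)]]
        n_Lie_zero[of 2, OF finsum_gen_wronskian_3[OF that(3)]]
      by (simp_all only:)
  qed
  \<comment> \<open>For \<open>k \<ge> 2\<close> the polynomial algebra with the Euler derivation is
    an instance of \<open>all\<close> that contradicts \<open>wronskian_not_n_Lie\<close>.\<close>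
  have converse: "k = 1"
    if p: "p = 0" and k: "k \<ge> 1"
      and all: "\<forall>(U :: ('k, 'k list) module) d. assoc_comm_algebra K U \<and> derivation K U d \<longrightarrow>
        n_Lie_multiplication K U (k + 1) (gen_wronskian U d [0..<k + 1])" for k
  proof (rule ccontr)
    assume "k \<noteq> 1"
    then have "k \<ge> 2" using k by simp
    then show False
      using K.wronskian_not_n_Lie[of k] all K.derivation_euler assms(2) p
        algebra_imp_assoc_comm_algebra[OF K.algebra_poly_algebra] by simp
  qed
  show ?thesis
    using zero2 zero3 converse
    by (auto intro!: nLie simp del: One_nat_def
        simp: dvd_alternant_defect_power2 dvd_alternant_defect_power3[simplified]
        dvd_alternant_defect_124 dvd_alternant_defect_234 dvd_alternant_defect_123
        dvd_alternant_defect_1234 dvd_alternant_defect_0123 dvd_alternant_defect_01234 alternant_defect_01)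
qed

end
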